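(* Suppose $n\geq 2$. Let $K>0$ be an absolute constant. Let $\widehat{D}$ be the cardinality of $\hat{m}^\bullet$ and let $\widehat{\mathrm{pen}}^\circ:\widehat{\mathcal{M}}^\bullet\to\mathbb{R}^+$ be the penalty $$\widehat{\mathrm{pen}}^\circ(m)=\Big(c_1+c_2\ln\big(\widehat{D}/D'_m\big)\Big)D'_m,$$ where $c_1$ and $c_2$ are positive. If $c_0$, $c_1$ and $c_2$ are large enough (larger than suitable absolute constants), then for all $p\in(0,2]$, $\alpha>1/p-1/2$ and $R$ such that $n^{-1/2}\leq R<n^\alpha$, $$\sup\Big\{\mathbb{E}_s\big[\|s-\tilde{s}_{hyb}\|^2\big]\ :\ s\in\mathscr{P}(\alpha,p,R),\ \|s^\bullet-s^\circ\|^2\leq K\ln(n)\Big\}\leq C\ln(n)\,\mathcal{R}(\alpha,p,R),$$ where $C$ depends only on $c_0,c_1,c_2,\alpha$ and $p$ (and on the fixed absolute constant $K$).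
   Context: Let $r\geq 2$ be an integer and $n=2^N$ a power of $2$. For an integer $q\ge1$, $\mathscr{M}(r,q)$ is the space of real $r\times q$ matrices; $t^{(l)}\in\mathbb{R}^q$ is the $l$-th row and $t_i\in\mathbb{R}^r$ the $i$-th column of $t$. The norm $\|\cdot\|$ on $\mathscr{M}(r,q)$ is $\|t\|=\big(\sum_{i,l}(t_i^{(l)})^2\big)^{1/2}$ (same notation for $q=n$ and $q=n/2$); $\langle\cdot,\cdot\rangle_n$ is the standard inner product on $\mathbb{R}^n$ and $\|\cdot\|_r$ the Euclidean norm on $\mathbb{R}^r$. $\mathscr{P}\subset\mathscr{M}(r,n)$ is the set of matrices all of whose columns are probability distributions on $\{1,\ldots,r\}$. Statistical framework. $Y_1,\ldots,Y_n$ are independent random variables with values in $\{1,\ldots,r\}$; their distribution is encoded by $s\in\mathscr{P}$ whose $i$-th column is $s_i=(\mathbb{P}(Y_i=1),\ldots,\mathbb{P}(Y_i=r))^T$. $X$ is the random $r\times n$ matrix with $i$-th column $X_i=(1_{Y_i=1},\ldots,1_{Y_i=r})^T$. $\mathbb{E}_s$ is expectation when the distribution is $s$. An estimator is a measurable function of $(Y_1,\ldots,Y_n)$ with values in $\mathscr{M}(r,n)$. Hybrid estimator. For $t\in\mathscr{M}(r,n)$, $t^\bullet$ (resp. $t^\circ$) is the element of $\mathscr{M}(r,n/2)$ formed by the columns of $t$ with even (resp. odd) indices. For a partition $m$ of $\{1,\ldots,n/2\}$ into intervals, $S'_m\subset\mathbb{R}^{n/2}$ is the linear span of the indicator vectors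 of the intervals $I\in m$, $D'_m=\dim S'_m$, and $\mathbb{R}^r\otimes S'_m$ is the subspace of $\mathscr{M}(r,n/2)$ of matrices whose rows all belong to $S'_m$. The dyadic intervals of $\{1,\ldots,n/2\}$, $n/2=2^{N-1}$, are the sets $\{k2^{N-1-j}+1,\ldots,(k+1)2^{N-1-j}\}$, $0\leq j\leq N-1$, $0\leq k\leq 2^j-1$, and $\mathcal{M}'$ is the set of partitions of $\{1,\ldots,n/2\}$ into dyadic intervals. Stage 1: with $\widehat{s^\bullet}_m=\operatorname{argmin}_{t\in\mathbb{R}^r\otimes S'_m}\|X^\bullet-t\|^2$, let $\hat{m}^\bullet$ be a minimizer over $m\in\mathcal{M}'$ of $\|X^\bullet-\widehat{s^\bullet}_m\|^2+c_0D'_m$, where $c_0>0$ is a constant. Stage 2: let $\widehat{\mathcal{M}}^\bullet$ be the (random) collection of all partitions of $\{1,\ldots,n/2\}$ into intervals that are built on $\hat{m}^\bullet$, i.e. each of whose intervals is a union of intervals of $\hat{m}^\bullet$. With $\widehat{s^\circ}_m=\operatorname{argmin}_{t\in\mathbb{R}^r\otimes S'_m}\|X^\circ-t\|^2$, let $\hat{m}^\circ$ be a minimizer over $m\in\widehat{\mathcal{M}}^\bullet$ of $\|X^\circ-\widehat{s^\circ}_m\|^2+\widehat{\mathrm{pen}}^\circ(m)$. The hybrid estimator $\tilde{s}_{hyb}$ is the random matrix in $\mathscr{M}(r,n)$ whose submatrix of even-indexed columns and whose submatrix of odd-indexed columns are both equal to $\widehat{s^\circ}_{\hat{m}^\circ}$.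 Haar basis and Besov bodies. For $0\leq j\leq N-1$ let $\Lambda(j)=\{(j,k):k=0,\ldots,2^j-1\}$. Let $\varphi:\mathbb{R}\to\{-1,0,1\}$ be equal to $1$ on $(0,1/2]$, $-1$ on $(1/2,1]$ and $0$ elsewhere. For $\lambda=(j,k)\in\Lambda(j)$, $\phi_\lambda\in\mathbb{R}^n$ has $i$-th coordinate $\frac{2^{j/2}}{\sqrt n}\varphi\big(2^j\frac{i}{n}-k\big)$. For $t\in\mathscr{M}(r,n)$ let $\beta_\lambda\in\mathbb{R}^r$ be the column vector with $l$-th coordinate $\beta_\lambda^{(l)}=\langle t^{(l)},\phi_\lambda\rangle_n$. For $\alpha,p,R>0$, $\mathscr{B}(\alpha,p,R)$ is the set of $t\in\mathscr{M}(r,n)$ such that $$\Big(\sum_{j=0}^{N-1}2^{jp(\alpha+1/2-1/p)}\sum_{\lambda\in\Lambda(j)}\|\beta_\lambda\|_r^p\Big)^{1/p}\leq\sqrt{n}\,R,$$ and $\mathscr{P}(\alpha,p,R)=\mathscr{P}\cap\mathscr{B}(\alpha,p,R)$. The minimax risk is $\mathcal{R}(\alpha,p,R)=\inf_{\hat{s}}\sup_{s\in\mathscr{P}(\alpha,p,R)}\mathbb{E}_s[\|s-\hat{s}\|^2]$, the infimum being over all estimators $\hat{s}$ of $s$. *)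

theory Defs
  imports
    "HOL-Probability.Probability"
    "HOL-Library.Disjoint_Sets"
    "HOL-Library.Function_Algebras"
begin

text \<open>
  The dimensions vary inside statements whose constants must not depend on them, so
  vectors of length q and r times q matrices are functions on nat, indexed from 1 as on paper and
  vanishing outside the index range. In \<open>t l i\<close> the row index l comes first, so \<open>t l\<close> is the l-th
  row of t. Sums and differences are the pointwise ones.
\<close>

type_synonym rvec = "nat \<Rightarrow> real"
type_synonym rmat = "nat \<Rightarrow> rvec"

interpretation rvec: vector_space "\<lambda>(c :: real) (v :: rvec) i. c * v i"
  by unfold_locales (auto simp: fun_eq_iff algebra_simps)

definition Mat :: "nat \<Rightarrow> nat \<Rightarrow> rmat set" where
  "Mat r q = {t. \<forall>l i. \<not> (l \<in> {1..r} \<and> i \<in> {1..q}) \<longrightarrow> t l i = 0}"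

definition mnorm :: "nat \<Rightarrow> nat \<Rightarrow> rmat \<Rightarrow> real" where
  "mnorm r q t = L2_set (\<lambda>(l, i). t l i) ({1..r} \<times> {1..q})"

text \<open>
  Submatrices of the columns with even and odd index. For a matrix, column 0 is zero, so both
  functions again have a zero column 0 (in the second one \<open>2 * 0 - 1\<close> truncates to 0).
\<close>

definition even_cols :: "rmat \<Rightarrow> rmat" where
  "even_cols t = (\<lambda>l i. t l (2 * i))"

definition odd_cols :: "rmat \<Rightarrow> rmat" where
  "odd_cols t = (\<lambda>l i. t l (2 * i - 1))"

definition prob_mats :: "nat \<Rightarrow> nat \<Rightarrow> rmat set" where
  "prob_mats r n =
     {s \<in> Mat r n. \<forall>i\<in>{1..n}. (\<forall>l\<in>{1..r}. 0 \<le> s l i) \<and> (\<Sum>l\<in>{1..r}. s l i) = 1}"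

text \<open>
  An observation is a realisation y of \<open>(Y\<^sub>1, \<dots>, Y\<^sub>n)\<close>, extended by 0 outside \<open>{1..n}\<close>. The law of
  the observation is the product of the laws on \<open>{1..r}\<close> given by the columns of s.
\<close>

definition observations :: "nat \<Rightarrow> nat \<Rightarrow> (nat \<Rightarrow> nat) set" where
  "observations r n = PiE_dflt {1..n} 0 (\<lambda>_. {1..r})"

definition law :: "nat \<Rightarrow> rmat \<Rightarrow> (nat \<Rightarrow> nat) pmf" where
  "law n s = Pi_pmf {1..n} 0 (\<lambda>i. embed_pmf (\<lambda>l. s l i))"

definition X_mat :: "nat \<Rightarrow> nat \<Rightarrow> (nat \<Rightarrow> nat) \<Rightarrow> rmat" where
  "X_mat r n y = (\<lambda>l i. if l \<in> {1..r} \<and> i \<in> {1..n} \<and> y i = l then 1 else 0)"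

text \<open>
  The observation space is finite and discrete, so every function on it is measurable.
\<close>

definition estimators :: "nat \<Rightarrow> nat \<Rightarrow> ((nat \<Rightarrow> nat) \<Rightarrow> rmat) set" where
  "estimators r n = observations r n \<rightarrow> Mat r n"

text \<open>Risks take values in \<open>[0, \<infinity>]\<close>, so that suprema and infima of risks always make sense.\<close>

definition risk :: "nat \<Rightarrow> nat \<Rightarrow> rmat \<Rightarrow> ((nat \<Rightarrow> nat) \<Rightarrow> rmat) \<Rightarrow> ennreal" where
  "risk r n s e = (\<integral>\<^sup>+ y. ennreal ((mnorm r n (s - e y))\<^sup>2) \<partial>measure_pmf (law n s))"

definition interval_partitions :: "nat \<Rightarrow> nat set set set" where
  "interval_partitions q = {m. partition_on {1..q} m \<and> (\<forall>I\<in>m. \<exists>a b. I = {a..b})}"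

definition dyadic_intervals :: "nat \<Rightarrow> nat set set" where
  "dyadic_intervals N =
     {{k * 2 ^ (N - 1 - j) + 1 .. (k + 1) * 2 ^ (N - 1 - j)} | j k. j \<le> N - 1 \<and> k \<le> 2 ^ j - 1}"

definition dyadic_partitions :: "nat \<Rightarrow> nat set set set" where
  "dyadic_partitions N = {m. partition_on {1..2 ^ (N - 1)} m \<and> m \<subseteq> dyadic_intervals N}"

definition built_on :: "nat \<Rightarrow> nat set set \<Rightarrow> nat set set set" where
  "built_on q m0 = {m \<in> interval_partitions q. \<forall>I\<in>m. \<exists>J\<subseteq>m0. I = \<Union>J}"

definition pc_space :: "nat set set \<Rightarrow> rvec set" where
  "pc_space m = rvec.span ((\<lambda>I. indicator I) ` m)"

definition pc_dim :: "nat set set \<Rightarrow> nat" where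
  "pc_dim m = rvec.dim (pc_space m)"

definition pc_mats :: "nat \<Rightarrow> nat \<Rightarrow> nat set set \<Rightarrow> rmat set" where
  "pc_mats r q m = {t \<in> Mat r q. \<forall>l\<in>{1..r}. t l \<in> pc_space m}"

definition lse :: "nat \<Rightarrow> nat \<Rightarrow> nat set set \<Rightarrow> rmat \<Rightarrow> rmat" where
  "lse r q m x = arg_min_on (\<lambda>t. (mnorm r q (x - t))\<^sup>2) (pc_mats r q m)"

definition hybrid_pen :: "real \<Rightarrow> real \<Rightarrow> nat set set \<Rightarrow> nat set set \<Rightarrow> real" where
  "hybrid_pen c1 c2 m0 m = (c1 + c2 * ln (real (card m0) / real (pc_dim m))) * real (pc_dim m)"

text \<open>
  The minimizers in both stages need not be unique; any choice is admitted. The partition selected in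
  the first stage is a function of the even-indexed columns \<open>X\<^sup>\<bullet>\<close> only.
\<close>

definition is_hybrid ::
    "real \<Rightarrow> real \<Rightarrow> real \<Rightarrow> nat \<Rightarrow> nat \<Rightarrow> ((nat \<Rightarrow> nat) \<Rightarrow> rmat) \<Rightarrow> bool" where
  "is_hybrid c0 c1 c2 r N e \<longleftrightarrow>
     (let n = 2 ^ N; q = 2 ^ (N - 1) in
      \<exists>(m_even :: rmat \<Rightarrow> nat set set) (m_odd :: (nat \<Rightarrow> nat) \<Rightarrow> nat set set).
        \<forall>y \<in> observations r n.
          (let x_even = even_cols (X_mat r n y); x_odd = odd_cols (X_mat r n y) in
           is_arg_min (\<lambda>m. (mnorm r q (x_even - lse r q m x_even))\<^sup>2 + c0 * real (pc_dim m))
             (\<lambda>m. m \<in> dyadic_partitions N) (m_even x_even) \<and>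
           is_arg_min (\<lambda>m. (mnorm r q (x_odd - lse r q m x_odd))\<^sup>2
                            + hybrid_pen c1 c2 (m_even x_even) m)
             (\<lambda>m. m \<in> built_on q (m_even x_even)) (m_odd y) \<and>
           e y \<in> Mat r n \<and>
           even_cols (e y) = lse r q (m_odd y) x_odd \<and>
           odd_cols (e y) = lse r q (m_odd y) x_odd))"

definition haar_mother :: "real \<Rightarrow> real" where
  "haar_mother x = (if 0 < x \<and> x \<le> 1 / 2 then 1 else if 1 / 2 < x \<and> x \<le> 1 then - 1 else 0)"

definition haar :: "nat \<Rightarrow> nat \<Rightarrow> nat \<Rightarrow> rvec" where
  "haar n j k = (\<lambda>i. 2 powr (real j / 2) / sqrt (real n)
                       * haar_mother (2 ^ j * (real i / real n) - real k))"

definition haar_coeff :: "nat \<Rightarrow> rmat \<Rightarrow> nat \<Rightarrow> nat \<Rightarrow> rvec" where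
  "haar_coeff n t j k = (\<lambda>l. \<Sum>i\<in>{1..n}. t l i * haar n j k i)"

definition besov_body :: "nat \<Rightarrow> nat \<Rightarrow> real \<Rightarrow> real \<Rightarrow> real \<Rightarrow> rmat set" where
  "besov_body r N \<alpha> p R =
     (let n = 2 ^ N in
      {t \<in> Mat r n.
         (\<Sum>j\<in>{0..N - 1}. 2 powr (real j * p * (\<alpha> + 1 / 2 - 1 / p))
             * (\<Sum>k\<in>{0..2 ^ j - 1}. (L2_set (haar_coeff n t j k) {1..r}) powr p)) powr (1 / p)
           \<le> sqrt (real n) * R})"

definition prob_besov :: "nat \<Rightarrow> nat \<Rightarrow> real \<Rightarrow> real \<Rightarrow> real \<Rightarrow> rmat set" where
  "prob_besov r N \<alpha> p R = prob_mats r (2 ^ N) \<inter> besov_body r N \<alpha> p R"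

definition minimax_risk :: "nat \<Rightarrow> nat \<Rightarrow> real \<Rightarrow> real \<Rightarrow> real \<Rightarrow> ennreal" where
  "minimax_risk r N \<alpha> p R =
     (INF e \<in> estimators r (2 ^ N). SUP s \<in> prob_besov r N \<alpha> p R. risk r (2 ^ N) s e)"

end

theory Submission
  imports Defs
begin

text \<open>
  Let \<open>\<rho> = (\<surd>n R)^(2/(2\<alpha>+1))\<close>, so that \<open>1 \<le> \<rho> < n\<close>. By Assouad's lemma on a hypercube of perturbations
  along the Haar functions of level \<open>\<lfloor>log\<^sub>2 \<rho>\<rfloor>\<close> in the first two rows, the minimax risk is at least \<open>\<rho>/16\<close>.

  For the upper bound, the squared norm of the noise projected on a model m has exponential
  moments of order \<open>exp(2|m|)\<close> with constants free of r, while the weights \<open>4^(-|m|)\<close> are summable over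
  dyadic partitions; hence this squared norm is at most a constant times |m| plus an integrable
  excess, uniformly in m. So the first stage satisfies an oracle inequality that also controls the
  size of the selected partition. The second stage may be compared with the choice of that very
  partition: every model it considers is contained in the corresponding one, so the same uniform
  bound, applied to the odd columns, suffices and no independence of the two halves is used. Finally
  the dyadic partition generated by the Haar coefficients of level at most \<open>log\<^sub>2 \<rho>\<close> or of norm larger
  than 1 has bias at most \<open>\<rho>\<close> and \<open>O(\<rho> ln n)\<close> pieces; the logarithm is the one
  allowed in front of the minimax risk.
\<close>

section \<open>Least squares on piecewise constant matrices\<close>

text \<open>Every loss inequality holds for each observation separately; the law enters only through
  the expectation of \<open>noise_excess\<close>, evaluated on the even and on the odd columns. A
  partition chosen from the data is harmless because the excess dominates all dyadic partitions at
  once. Constants free of r come from (1_{l=j} - p_j)^2 \<le> 1_{l=j} + p_j, whose sum over j is 2: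
  a column of noise has bounded norm however many rows it has. The weight 1/4 per piece is the
  largest w for which x = w + x^2, the recursion over the halves of a block, has a real fixed point.
  The bias lives on n/2 columns while the Besov condition concerns Haar coefficients on n columns;
  the bridge is that the even columns vary on a block no more than the full matrix does on the block
  twice as long. The threshold 1 makes a single tail sum of p-th powers bound both the discarded
  energy and the number of kept fine coefficients, since p \<le> 2. The logarithm is a path length:
  isolating one kept coefficient may force a split at every level above it.\<close>

lemma sum_fun_apply: "(\<Sum>x\<in>A. f x) i = (\<Sum>x\<in>A. f x i)"
  for f :: "'a \<Rightarrow> 'b \<Rightarrow> 'c::comm_monoid_add"
  by (induction A rule: infinite_finite_induct) auto

lemma pc_space_const_on:
  assumes "disjoint m" "v \<in> pc_space m" "I \<in> m" "i \<in> I" "i' \<in> I"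
  shows "v i = v i'"
proof (rule rvec.span_induct[of v "(\<lambda>I. indicator I) ` m" "\<lambda>v. v i = v i'"])
  show "v \<in> rvec.span ((\<lambda>I. indicator I) ` m)"
    using assms(2) by (simp add: pc_space_def)
  show "rvec.subspace {v. v i = v i'}"
    by (auto simp: rvec.subspace_def)
  fix w :: rvec assume "w \<in> (\<lambda>I. indicator I) ` m"
  then obtain J where J: "J \<in> m" "w = indicator J" by auto
  then have "J = I \<or> J \<inter> I = {}"
    using assms(1,3) by (auto simp: disjoint_def)
  then show "w i = w i'"
    using assms(4,5) J by (auto simp: indicator_def)
qed

lemma sum_indicator_pc_space:
  assumes "finite m"
  shows "(\<lambda>i. \<Sum>I\<in>m. c I * indicator I i) \<in> pc_space m"
proof -
  have "(\<Sum>I\<in>m. (\<lambda>i. c I * indicator I i)) \<in> pc_space m"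
    unfolding pc_space_def
    by (intro rvec.span_sum rvec.span_scale rvec.span_base) auto
  then show ?thesis
    by (simp add: sum_fun_apply[abs_def])
qed

lemma sum_mult_indicator_disjoint:
  fixes c :: "'a set \<Rightarrow> real"
  assumes "finite m" "disjoint m" "I \<in> m" "i \<in> I"
  shows "(\<Sum>J\<in>m. c J * indicator J i) = c I"
proof -
  have "(\<Sum>J\<in>m. c J * indicator J i) = (\<Sum>J\<in>m. if J = I then c J else 0)"
    using assms by (intro sum.cong) (auto simp: disjoint_def indicator_def)
  then show ?thesis using assms by simp
qed

lemma pc_dim_eq_card:
  assumes "finite m" "disjoint m" "{} \<notin> m"
  shows "pc_dim m = card m"
proof -
  let ?f = "\<lambda>I. indicator I :: rvec"
  have inj: "inj_on ?f m"
    by (intro inj_onI set_eqI) (metis indicator_eq_0_iff)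
  have "rvec.independent (?f ` m)"
  proof
    assume "rvec.dependent (?f ` m)"
    then obtain u J where u: "J \<in> m" "u (?f J) \<noteq> 0" "(\<Sum>v\<in>?f ` m. (\<lambda>i. u v * v i)) = 0"
      using assms(1) by (auto simp: rvec.dependent_finite)
    from u(1) assms(3) obtain i where i: "i \<in> J" by fastforce
    have "(\<Sum>v\<in>?f ` m. (\<lambda>i. u v * v i)) i = (\<Sum>K\<in>m. u (?f K) * ?f K i)"
      unfolding sum_fun_apply using inj by (subst sum.reindex) auto
    also have "\<dots> = u (?f J)"
      using sum_mult_indicator_disjoint[OF assms(1,2) u(1) i, of "\<lambda>K. u (?f K)"] by simp
    finally show False using u by (simp add: zero_fun_def)
  qed
  then show ?thesis
    unfolding pc_dim_def pc_space_def
    using rvec.dim_span_eq_card_independent card_image[OF inj] by simp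
qed

lemma mnorm_sq: "(mnorm r q t)\<^sup>2 = (\<Sum>l\<in>{1..r}. \<Sum>i\<in>{1..q}. (t l i)\<^sup>2)"
  unfolding mnorm_def L2_set_def
  by (subst real_sqrt_pow2) (auto simp: sum.cartesian_product intro!: sum_nonneg sum.cong)

lemma sum_partition_on:
  assumes "partition_on A m" "finite A"
  shows "(\<Sum>i\<in>A. f i) = (\<Sum>I\<in>m. \<Sum>i\<in>I. f i)"
proof -
  have "(\<Sum>i\<in>\<Union>m. f i) = (\<Sum>I\<in>m. \<Sum>i\<in>I. f i)"
    using assms by (subst sum.Union_disjoint)
      (auto simp: partition_on_def disjoint_def dest: finite_subset[OF Union_upper])
  then show ?thesis using assms by (auto simp: partition_on_def)
qed

lemma partition_on_finite_members:
  assumes "partition_on A m" "finite A" "I \<in> m"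
  shows "finite I" "I \<noteq> {}" "0 < card I"
proof -
  show "finite I" using assms by (auto simp: partition_on_def intro: finite_subset)
  show "I \<noteq> {}" using assms by (auto simp: partition_on_def)
  then show "0 < card I" using \<open>finite I\<close> by auto
qed

text \<open>Summed over the pieces of a partition, this is the squared norm of the orthogonal
  projection of z onto the piecewise constant matrices.\<close>

definition block_energy :: "nat \<Rightarrow> rmat \<Rightarrow> nat set \<Rightarrow> real" where
  "block_energy r z I = (\<Sum>l\<in>{1..r}. (\<Sum>i\<in>I. z l i)\<^sup>2) / real (card I)"

lemma block_energy_nonneg: "0 \<le> block_energy r z I"
  by (auto simp: block_energy_def intro!: divide_nonneg_nonneg sum_nonneg)

text \<open>Young's inequality block by block: a block-constant w sees only the block sums of z.
  Constancy is assumed entrywise because w will be a difference of elements of two models, constant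
  on a common refinement. The weight 1/4 is small enough for the w term to be absorbed
  later.\<close>

lemma inner_block_constant_le:
  assumes m: "partition_on {1..q} m"
    and w: "\<And>l I i i'. l \<in> {1..r} \<Longrightarrow> I \<in> m \<Longrightarrow> i \<in> I \<Longrightarrow> i' \<in> I \<Longrightarrow> w l i = w l i'"
  shows "2 * (\<Sum>l\<in>{1..r}. \<Sum>i\<in>{1..q}. z l i * w l i) \<le>
    (\<Sum>l\<in>{1..r}. \<Sum>i\<in>{1..q}. (w l i)\<^sup>2) / 4 + 4 * (\<Sum>I\<in>m. block_energy r z I)"
proof -
  have block: "2 * (\<Sum>i\<in>I. z l i * w l i)
      \<le> (\<Sum>i\<in>I. (w l i)\<^sup>2) / 4 + 4 * ((\<Sum>i\<in>I. z l i)\<^sup>2 / real (card I))"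
    if l: "l \<in> {1..r}" and I: "I \<in> m" for l I
  proof -
    note I' = partition_on_finite_members[OF m finite_atLeastAtMost I]
    then obtain i0 where i0: "i0 \<in> I" by auto
    define c where "c = w l i0"
    have wc: "w l i = c" if "i \<in> I" for i using w[OF l I that i0] by (simp add: c_def)
    let ?S = "\<Sum>i\<in>I. z l i" and ?k = "real (card I)"
    have "0 \<le> (?k * c - 4 * ?S)\<^sup>2 / (4 * ?k)" by simp
    also have "\<dots> = ?k * c\<^sup>2 / 4 + 4 * (?S\<^sup>2 / ?k) - 2 * (?S * c)"
      using I'(3) by (simp add: power2_eq_square field_simps)
    finally have "2 * (?S * c) \<le> ?k * c\<^sup>2 / 4 + 4 * (?S\<^sup>2 / ?k)" by simp
    moreover have "(\<Sum>i\<in>I. z l i * w l i) = ?S * c"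
      using wc by (simp add: sum_distrib_right)
    moreover have "(\<Sum>i\<in>I. (w l i)\<^sup>2) = ?k * c\<^sup>2" using wc by simp
    ultimately show ?thesis by simp
  qed
  have "2 * (\<Sum>l\<in>{1..r}. \<Sum>i\<in>{1..q}. z l i * w l i)
      = (\<Sum>l\<in>{1..r}. \<Sum>I\<in>m. 2 * (\<Sum>i\<in>I. z l i * w l i))"
    unfolding sum_partition_on[OF m finite_atLeastAtMost] by (simp add: sum_distrib_left)
  also have "\<dots> \<le> (\<Sum>l\<in>{1..r}. \<Sum>I\<in>m. (\<Sum>i\<in>I. (w l i)\<^sup>2) / 4 + 4 * ((\<Sum>i\<in>I. z l i)\<^sup>2 / real (card I)))"
    by (intro sum_mono block) auto
  also have "\<dots> = (\<Sum>l\<in>{1..r}. (\<Sum>I\<in>m. (\<Sum>i\<in>I. (w l i)\<^sup>2)) / 4)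
      + (\<Sum>l\<in>{1..r}. \<Sum>I\<in>m. 4 * ((\<Sum>i\<in>I. z l i)\<^sup>2 / real (card I)))"
    by (simp add: sum.distrib sum_divide_distrib)
  also have "(\<Sum>l\<in>{1..r}. \<Sum>I\<in>m. 4 * ((\<Sum>i\<in>I. z l i)\<^sup>2 / real (card I)))
      = 4 * (\<Sum>I\<in>m. block_energy r z I)"
    by (subst sum.swap) (simp add: block_energy_def sum_distrib_left sum_divide_distrib)
  also have "(\<Sum>l\<in>{1..r}. (\<Sum>I\<in>m. (\<Sum>i\<in>I. (w l i)\<^sup>2)) / 4)
      = (\<Sum>l\<in>{1..r}. \<Sum>i\<in>{1..q}. (w l i)\<^sup>2) / 4"
    unfolding sum_partition_on[OF m finite_atLeastAtMost] by (simp add: sum_divide_distrib)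
  finally show ?thesis .
qed

lemma square_diff_le: "(a - b)\<^sup>2 \<le> 2 * (c - a)\<^sup>2 + 2 * (c - b)\<^sup>2" for a b c :: real
proof -
  have "0 \<le> ((c - a) + (c - b))\<^sup>2" by simp
  then show ?thesis by (simp add: power2_eq_square algebra_simps)
qed

text \<open>Expanding both squares about s leaves the cross term 2 <x - s, t - u>. Young's
  inequality charges it with |t - u|^2 / 4 \<le> (|s - t|^2 + |s - u|^2) / 2, which turns the
  coefficients 1 into 1/2 on the left and 3/2 on the right, plus four times the projected noise. The
  numbers a and b stand for penalties.\<close>

lemma selection_inequality:
  assumes m: "partition_on {1..q} m"
    and w: "\<And>l I i i'. l \<in> {1..r} \<Longrightarrow> I \<in> m \<Longrightarrow> i \<in> I \<Longrightarrow> i' \<in> I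
      \<Longrightarrow> t l i - u l i = t l i' - u l i'"
    and sel: "(mnorm r q (x - t))\<^sup>2 + a \<le> (mnorm r q (x - u))\<^sup>2 + b"
  shows "(mnorm r q (s - t))\<^sup>2 / 2 + a
    \<le> 3 / 2 * (mnorm r q (s - u))\<^sup>2 + b + 4 * (\<Sum>I\<in>m. block_energy r (x - s) I)"
proof -
  let ?S = "\<lambda>f. (\<Sum>l\<in>{1..r}. \<Sum>i\<in>{1..q}. f l i :: real)"
  have 1: "2 * ?S (\<lambda>l i. (x - s) l i * (t l i - u l i)) \<le>
     ?S (\<lambda>l i. (t l i - u l i)\<^sup>2) / 4 + 4 * (\<Sum>I\<in>m. block_energy r (x - s) I)"
    using inner_block_constant_le[OF m, of r "\<lambda>l i. t l i - u l i"] w by blast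
  have 2: "?S (\<lambda>l i. (t l i - u l i)\<^sup>2) \<le> ?S (\<lambda>l i. 2 * (s l i - t l i)\<^sup>2 + 2 * (s l i - u l i)\<^sup>2)"
    by (intro sum_mono) (rule square_diff_le)
  have 3: "?S (\<lambda>l i. (x l i - u l i)\<^sup>2) - ?S (\<lambda>l i. (x l i - t l i)\<^sup>2)
    = ?S (\<lambda>l i. (s l i - u l i)\<^sup>2) - ?S (\<lambda>l i. (s l i - t l i)\<^sup>2) + 2 * ?S (\<lambda>l i. (x - s) l i * (t l i - u l i))"
    by (simp add: sum_distrib_left sum_subtractf[symmetric] sum.distrib[symmetric])
       (intro sum.cong refl, simp add: power2_eq_square algebra_simps)
  show ?thesis
    using 1 2 3 sel by (simp add: mnorm_sq sum.distrib sum_distrib_left[symmetric])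
qed

text \<open>\<open>lse\<close> is defined by choice, so a concrete minimizer has to be exhibited
  before its minimality can be used. Applied to the true matrix, this is also the deterministic
  comparison point of the oracle inequality.\<close>

definition block_mean :: "nat \<Rightarrow> nat set set \<Rightarrow> rmat \<Rightarrow> rmat" where
  "block_mean r m x = (\<lambda>l i. if l \<in> {1..r} then
     (\<Sum>I\<in>m. (\<Sum>i\<in>I. x l i) / real (card I) * indicator I i) else 0)"

lemma block_mean_eq:
  assumes "partition_on {1..q} m" "l \<in> {1..r}" "I \<in> m" "i \<in> I"
  shows "block_mean r m x l i = (\<Sum>i\<in>I. x l i) / real (card I)"
  using assms
    sum_mult_indicator_disjoint[of m I i "\<lambda>I. (\<Sum>i\<in>I. x l i) / real (card I)"]
  by (auto simp: block_mean_def partition_onD2 intro: finite_elements)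

lemma block_mean_pc_mats:
  assumes "partition_on {1..q} m"
  shows "block_mean r m x \<in> pc_mats r q m"
proof -
  have fin: "finite m" using assms by (auto intro: finite_elements)
  have "block_mean r m x l i = 0" if "i \<notin> {1..q}" for l i
  proof -
    have "i \<notin> I" if "I \<in> m" for I
      using that \<open>i \<notin> {1..q}\<close> partition_onD1[OF assms] by blast
    then show ?thesis by (simp add: block_mean_def)
  qed
  moreover have "block_mean r m x l i = 0" if "l \<notin> {1..r}" for l i
    using that by (auto simp: block_mean_def)
  moreover have "block_mean r m x l \<in> pc_space m" if "l \<in> {1..r}" for l
    using sum_indicator_pc_space[OF fin, of "\<lambda>I. (\<Sum>i\<in>I. x l i) / real (card I)"] that
    by (simp add: block_mean_def)
  ultimately show ?thesis by (auto simp: pc_mats_def Mat_def)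
qed

lemma pc_mats_const_on:
  assumes "partition_on {1..q} m" "t \<in> pc_mats r q m" "l \<in> {1..r}" "I \<in> m" "i \<in> I" "i' \<in> I"
  shows "t l i = t l i'"
  using assms pc_space_const_on[of m "t l" I i i'] by (auto simp: pc_mats_def partition_onD2)

text \<open>On one block the squared error of a constant is a quadratic whose vertex is the mean;
  the excess at c is (S - k c)^2 / k.\<close>

lemma block_mean_minimal:
  assumes m: "partition_on {1..q} m" and t: "t \<in> pc_mats r q m"
  shows "(mnorm r q (x - block_mean r m x))\<^sup>2 \<le> (mnorm r q (x - t))\<^sup>2"
  unfolding mnorm_sq
proof (rule sum_mono)
  fix l assume l: "l \<in> {1..r}"
  have "(\<Sum>i\<in>I. ((x - block_mean r m x) l i)\<^sup>2) \<le> (\<Sum>i\<in>I. ((x - t) l i)\<^sup>2)" if I: "I \<in> m" for I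
  proof -
    note I' = partition_on_finite_members[OF m finite_atLeastAtMost I]
    then obtain i0 where i0: "i0 \<in> I" by auto
    define c where "c = t l i0"
    have tc: "t l i = c" if "i \<in> I" for i
      using pc_mats_const_on[OF m t l I that i0] by (simp add: c_def)
    define S where "S = (\<Sum>i\<in>I. x l i)"
    let ?k = "real (card I)"
    have sq: "(\<Sum>i\<in>I. (x l i - d)\<^sup>2) = (\<Sum>i\<in>I. (x l i)\<^sup>2) - 2 * d * S + ?k * d\<^sup>2" for d
      by (simp add: power2_diff sum.distrib sum_subtractf S_def sum_distrib_left algebra_simps)
    have "(\<Sum>i\<in>I. ((x - block_mean r m x) l i)\<^sup>2) = (\<Sum>i\<in>I. (x l i - S / ?k)\<^sup>2)"
      using block_mean_eq[OF m l I] by (simp add: S_def)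
    moreover have "(\<Sum>i\<in>I. ((x - t) l i)\<^sup>2) = (\<Sum>i\<in>I. (x l i - c)\<^sup>2)" using tc by simp
    moreover have "0 \<le> (S - ?k * c)\<^sup>2 / ?k" by simp
    moreover have "(S - ?k * c)\<^sup>2 / ?k = (- 2 * c * S + ?k * c\<^sup>2) - (- 2 * (S / ?k) * S + ?k * (S / ?k)\<^sup>2)"
      using I'(3) by (simp add: power2_eq_square field_simps)
    ultimately show ?thesis unfolding sq by simp
  qed
  then show "(\<Sum>i\<in>{1..q}. ((x - block_mean r m x) l i)\<^sup>2) \<le> (\<Sum>i\<in>{1..q}. ((x - t) l i)\<^sup>2)"
    unfolding sum_partition_on[OF m finite_atLeastAtMost] by (rule sum_mono)
qed

lemma lse_minimizer:
  assumes m: "partition_on {1..q} m"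
  shows lse_pc_mats: "lse r q m x \<in> pc_mats r q m"
    and lse_le: "t \<in> pc_mats r q m \<Longrightarrow> (mnorm r q (x - lse r q m x))\<^sup>2 \<le> (mnorm r q (x - t))\<^sup>2"
proof -
  let ?f = "\<lambda>t. (mnorm r q (x - t))\<^sup>2"
  have "is_arg_min ?f (\<lambda>t. t \<in> pc_mats r q m) (block_mean r m x)"
    using block_mean_pc_mats[OF m] block_mean_minimal[OF m] by (auto simp: is_arg_min_linorder)
  then have "is_arg_min ?f (\<lambda>t. t \<in> pc_mats r q m) (lse r q m x)"
    unfolding lse_def arg_min_on_def arg_min_def by (rule someI[of "is_arg_min ?f (\<lambda>t. t \<in> pc_mats r q m)"])
  then show "lse r q m x \<in> pc_mats r q m"
    and "t \<in> pc_mats r q m \<Longrightarrow> ?f (lse r q m x) \<le> ?f t"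
    by (auto simp: is_arg_min_linorder)
qed

section \<open>Dyadic partitions\<close>

definition blk :: "nat \<Rightarrow> nat \<Rightarrow> nat set" where
  "blk L k = {k * L + 1 .. (k + 1) * L}"

text \<open>Indices start at 1, so the position of i at scale L is a quotient of i - 1. Nesting of
  dyadic blocks then becomes iterated division.\<close>

lemma mem_blk_iff: "0 < L \<Longrightarrow> i \<in> blk L k \<longleftrightarrow> 1 \<le> i \<and> (i - 1) div L = k"
proof -
  assume L: "0 < L"
  show ?thesis
  proof (cases i)
    case (Suc i')
    then have "i \<in> blk L k \<longleftrightarrow> k * L \<le> i' \<and> i' < k * L + L"
      by (auto simp: blk_def)
    also have "\<dots> \<longleftrightarrow> i' div L = k"
      using L by (metis add.commute div_nat_eqI dividend_less_div_times div_times_less_eq_dividend mult.commute mult_Suc)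
    finally show ?thesis using Suc by simp
  qed (simp add: blk_def)
qed

lemma finite_blk [simp]: "finite (blk L k)"
  and card_blk [simp]: "card (blk L k) = L"
  by (simp_all add: blk_def)

lemma blk_nonempty [simp]: "0 < L \<Longrightarrow> blk L k \<noteq> {}"
  by (simp add: blk_def)

lemma blk_split:
  "0 < L \<Longrightarrow> blk (2 * L) k = blk L (2 * k) \<union> blk L (2 * k + 1)"
  "0 < L \<Longrightarrow> blk L (2 * k) \<inter> blk L (2 * k + 1) = {}"
  by (auto simp: blk_def)

lemma blk_nested:
  assumes "h \<le> h'" "blk (2 ^ h) k \<inter> blk (2 ^ h') k' \<noteq> {}"
  shows "blk (2 ^ h) k \<subseteq> blk (2 ^ h') k'"
proof -
  have "(i - 1) div 2 ^ h' = ((i - 1) div 2 ^ h) div 2 ^ (h' - h)" for i :: nat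
    using assms(1) by (simp add: div_mult2_eq[symmetric] power_add[symmetric])
  then show ?thesis using assms(2) by (auto simp: mem_blk_iff)
qed

definition dyadic_blocks :: "nat set set" where
  "dyadic_blocks = {blk (2 ^ h) k | h k. True}"

lemma dyadic_blocks_cases:
  assumes "I \<in> dyadic_blocks" "J \<in> dyadic_blocks"
  shows "I \<inter> J = {} \<or> I \<subseteq> J \<or> J \<subseteq> I"
proof -
  obtain h k h' k' where "I = blk (2 ^ h) k" "J = blk (2 ^ h') k'"
    using assms by (auto simp: dyadic_blocks_def)
  then show ?thesis
    using blk_nested[of h h' k k'] blk_nested[of h' h k' k] by (cases "h \<le> h'") auto
qed

text \<open>An arbitrary block instead of the root alone, so that the recursion over the two halves
  is an induction on h.\<close>

definition dyadic_block_partitions :: "nat \<Rightarrow> nat \<Rightarrow> nat set set set" where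
  "dyadic_block_partitions h k = {m. partition_on (blk (2 ^ h) k) m \<and> m \<subseteq> dyadic_blocks}"

lemma finite_dyadic_block_partitions [simp]: "finite (dyadic_block_partitions h k)"
  by (rule finite_subset[OF _ finitely_many_partition_on[OF finite_blk]])
     (auto simp: dyadic_block_partitions_def)

lemma dyadic_intervals_alt:
  "dyadic_intervals N = {blk (2 ^ (N - 1 - j)) k | j k. j \<le> N - 1 \<and> k \<le> 2 ^ j - 1}"
  by (simp add: dyadic_intervals_def blk_def)

lemma dyadic_partitions_subset: "dyadic_partitions N \<subseteq> dyadic_block_partitions (N - 1) 0"
  by (auto simp: dyadic_partitions_def dyadic_block_partitions_def dyadic_blocks_def
      dyadic_intervals_alt blk_def) blast

lemma partition_on_restrict_subset:
  assumes "partition_on A m" "L \<subseteq> A" "\<And>I. I \<in> m \<Longrightarrow> I \<subseteq> L \<or> I \<inter> L = {}"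
  shows "partition_on L {I \<in> m. I \<subseteq> L}"
proof (rule partition_onI)
  show "\<Union>{I \<in> m. I \<subseteq> L} = L"
  proof
    show "L \<subseteq> \<Union>{I \<in> m. I \<subseteq> L}"
    proof
      fix x assume x: "x \<in> L"
      then obtain I where "I \<in> m" "x \<in> I" using assms(1,2) by (auto simp: partition_on_def)
      then show "x \<in> \<Union>{I \<in> m. I \<subseteq> L}" using assms(3) x by blast
    qed
  qed auto
qed (use assms(1) in \<open>auto simp: partition_on_def disjoint_def disjnt_def\<close>)

text \<open>A dyadic piece longer than a half and contained in the block would be the whole block,
  hence the only piece; in any other partition every piece lies in one half.\<close>

lemma dyadic_block_partitions_Suc:
  assumes m: "m \<in> dyadic_block_partitions (Suc h) k" "m \<noteq> {blk (2 ^ Suc h) k}"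
  shows "\<exists>a \<in> dyadic_block_partitions h (2 * k). \<exists>b \<in> dyadic_block_partitions h (2 * k + 1).
    m = a \<union> b \<and> card m = card a + card b"
proof -
  let ?A = "blk (2 ^ Suc h) k" and ?L = "blk (2 ^ h) (2 * k)" and ?R = "blk (2 ^ h) (2 * k + 1)"
  have A: "?A = ?L \<union> ?R" and LR: "?L \<inter> ?R = {}"
    using blk_split[of "2 ^ h" k] by simp_all
  have p: "partition_on ?A m" and d: "m \<subseteq> dyadic_blocks"
    using m(1) by (auto simp: dyadic_block_partitions_def)
  have half: "I \<subseteq> ?L \<or> I \<subseteq> ?R" if I: "I \<in> m" for I
  proof -
    have sub: "I \<subseteq> ?A" and ne: "I \<noteq> {}" using p I by (auto simp: partition_on_def)
    obtain a b where ab: "I = blk (2 ^ a) b" using d I by (auto simp: dyadic_blocks_def)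
    have "\<not> Suc h \<le> a"
    proof
      assume "Suc h \<le> a"
      moreover have "?A \<inter> blk (2 ^ a) b \<noteq> {}" using sub ne unfolding ab by blast
      ultimately have "?A \<subseteq> I" using blk_nested[of "Suc h" a k b] ab by simp
      then have "I = ?A" using sub by auto
      have "m = {?A}"
      proof -
        have "J = ?A" if "J \<in> m" for J
        proof (rule ccontr)
          assume "J \<noteq> ?A"
          then have "J \<inter> ?A = {}" using p I that \<open>I = ?A\<close> by (auto simp: partition_on_def disjoint_def)
          moreover have "J \<subseteq> ?A" "J \<noteq> {}" using p that by (auto simp: partition_on_def)
          ultimately show False by blast
        qed
        then show ?thesis using I by blast
      qed
      then show False using m(2) by simp
    qed
    then have "a \<le> h" by simp
    moreover have "I \<inter> ?L \<noteq> {} \<or> I \<inter> ?R \<noteq> {}" using sub ne unfolding A by blast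
    ultimately show ?thesis
      using blk_nested[of a h b "2 * k"] blk_nested[of a h b "2 * k + 1"] unfolding ab by argo
  qed
  let ?a = "{I \<in> m. I \<subseteq> ?L}" and ?b = "{I \<in> m. I \<subseteq> ?R}"
  have "partition_on ?L ?a"
  proof (rule partition_on_restrict_subset[OF p])
    show "?L \<subseteq> ?A" unfolding A by (rule Un_upper1)
    show "I \<subseteq> ?L \<or> I \<inter> ?L = {}" if "I \<in> m" for I using half[OF that] LR by blast
  qed
  moreover have "partition_on ?R ?b"
  proof (rule partition_on_restrict_subset[OF p])
    show "?R \<subseteq> ?A" unfolding A by (rule Un_upper2)
    show "I \<subseteq> ?R \<or> I \<inter> ?R = {}" if "I \<in> m" for I using half[OF that] LR by blast
  qed
  ultimately have ab: "?a \<in> dyadic_block_partitions h (2 * k)" "?b \<in> dyadic_block_partitions h (2 * k + 1)"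
    using d by (auto simp: dyadic_block_partitions_def)
  have fin: "finite m" by (rule finite_elements[OF finite_blk p])
  have u: "m = ?a \<union> ?b" using half by blast
  have "?a \<inter> ?b = {}" using LR p by (auto simp: partition_on_def) (metis Int_greatest subset_empty)
  then have "card (?a \<union> ?b) = card ?a + card ?b"
    using fin by (intro card_Un_disjoint) auto
  then have "card m = card ?a + card ?b" using u by simp
  then show ?thesis using ab u by blast
qed

lemma dyadic_block_partitions_0: "dyadic_block_partitions 0 k \<subseteq> {{blk (2 ^ 0) k}}"
proof
  fix m assume "m \<in> dyadic_block_partitions 0 k"
  then have p: "partition_on {k + 1} m" by (simp add: dyadic_block_partitions_def blk_def)
  have "I = {k + 1}" if "I \<in> m" for I
  proof -
    have "I \<subseteq> {k + 1}" "I \<noteq> {}" using p that by (auto simp: partition_on_def)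
    then show ?thesis by blast
  qed
  moreover have "m \<noteq> {}" using p by (auto simp: partition_on_def)
  ultimately show "m \<in> {{blk (2 ^ 0) k}}" by (auto simp: blk_def)
qed

text \<open>A partition is trivial or a pair of partitions of the halves, so the sums obey x' \<le>
  1/4 + x^2, a map that fixes 1/2. The weight 1/4 matches the growth 4^d of the Catalan numbers,
  which count binary trees by leaves.\<close>

lemma sum_dyadic_block_partitions_le:
  "(\<Sum>m\<in>dyadic_block_partitions h k. (1 / 4 :: real) ^ card m) \<le> 1 / 2"
proof (induction h arbitrary: k)
  case 0
  have "(\<Sum>m\<in>dyadic_block_partitions 0 k. (1 / 4 :: real) ^ card m)
      \<le> (\<Sum>m\<in>{{blk (2 ^ 0) k}}. (1 / 4) ^ card m)"
    by (rule sum_mono2) (use dyadic_block_partitions_0 in auto)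
  then show ?case by simp
next
  case (Suc h)
  let ?P = "dyadic_block_partitions" and ?w = "\<lambda>m :: nat set set. (1 / 4 :: real) ^ card m"
  let ?S = "?P (Suc h) k - {{blk (2 ^ Suc h) k}}"
  \<comment> \<open>A chosen pair of partitions of the halves determines m as its union, so the sum
    over nontrivial m injects into the sum over all pairs.\<close>
  define sp where "sp m = (SOME ab. fst ab \<in> ?P h (2 * k) \<and> snd ab \<in> ?P h (2 * k + 1)
    \<and> m = fst ab \<union> snd ab \<and> card m = card (fst ab) + card (snd ab))" for m
  have sp: "fst (sp m) \<in> ?P h (2 * k) \<and> snd (sp m) \<in> ?P h (2 * k + 1)
    \<and> m = fst (sp m) \<union> snd (sp m) \<and> card m = card (fst (sp m)) + card (snd (sp m))" if "m \<in> ?S" for m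
    unfolding sp_def by (rule someI_ex) (use dyadic_block_partitions_Suc[of m h k] that in auto)
  have inj: "inj_on sp ?S" by (rule inj_onI) (metis sp)
  have "sum ?w (?P (Suc h) k) \<le> sum ?w (insert {blk (2 ^ Suc h) k} ?S)"
    by (intro sum_mono2) auto
  also have "\<dots> = 1 / 4 + sum ?w ?S" by (subst sum.insert) auto
  also have "sum ?w ?S = (\<Sum>m\<in>?S. ?w (fst (sp m)) * ?w (snd (sp m)))"
    using sp by (intro sum.cong refl) (metis power_add)
  also have "\<dots> = (\<Sum>(a, b)\<in>sp ` ?S. ?w a * ?w b)"
    using inj by (subst sum.reindex) (auto simp: case_prod_unfold)
  also have "\<dots> \<le> (\<Sum>(a, b)\<in>?P h (2 * k) \<times> ?P h (2 * k + 1). ?w a * ?w b)"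
  proof (rule sum_mono2)
    show "sp ` ?S \<subseteq> ?P h (2 * k) \<times> ?P h (2 * k + 1)"
      using sp by (metis image_subsetI mem_Times_iff)
  qed auto
  also have "\<dots> = sum ?w (?P h (2 * k)) * sum ?w (?P h (2 * k + 1))"
    by (simp add: sum_product sum.cartesian_product)
  also have "\<dots> \<le> 1 / 2 * (1 / 2)"
    by (intro mult_mono Suc.IH) (auto intro: sum_nonneg)
  finally show ?case by simp
qed

section \<open>Common refinements of dyadic partitions\<close>

definition common_refinement :: "nat set set \<Rightarrow> nat set set \<Rightarrow> nat set set" where
  "common_refinement m m' = {I \<inter> J | I J. I \<in> m \<and> J \<in> m' \<and> I \<inter> J \<noteq> {}}"

lemma partition_on_common_refinement:
  assumes "partition_on A m" "partition_on A m'"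
  shows "partition_on A (common_refinement m m')"
proof (rule partition_onI)
  show "\<Union> (common_refinement m m') = A"
  proof
    show "A \<subseteq> \<Union> (common_refinement m m')"
    proof
      fix x assume "x \<in> A"
      then obtain I J where "I \<in> m" "x \<in> I" "J \<in> m'" "x \<in> J"
        using assms by (auto simp: partition_on_def) blast
      then have "I \<inter> J \<in> common_refinement m m'" "x \<in> I \<inter> J"
        by (auto simp: common_refinement_def)
      then show "x \<in> \<Union> (common_refinement m m')" by blast
    qed
  qed (use assms in \<open>auto simp: common_refinement_def partition_on_def\<close>)
next
  fix p q assume "p \<in> common_refinement m m'" "q \<in> common_refinement m m'" "p \<noteq> q"
  then obtain I J I' J' where "I \<in> m" "J \<in> m'" "p = I \<inter> J" "I' \<in> m" "J' \<in> m'" "q = I' \<inter> J'"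
    by (auto simp: common_refinement_def)
  then show "disjnt p q"
    using assms \<open>p \<noteq> q\<close> unfolding partition_on_def disjoint_def disjnt_def by blast
qed (auto simp: common_refinement_def)

text \<open>Dyadic blocks that meet are nested, so the refinement creates no new piece. Its noise
  therefore costs at most the energies of the two models.\<close>

lemma common_refinement_dyadic:
  assumes "m \<subseteq> dyadic_blocks" "m' \<subseteq> dyadic_blocks"
  shows "common_refinement m m' \<subseteq> m \<union> m'"
proof
  fix K assume "K \<in> common_refinement m m'"
  then obtain I J where "I \<in> m" "J \<in> m'" "I \<inter> J \<noteq> {}" "K = I \<inter> J"
    by (auto simp: common_refinement_def)
  moreover have "I \<inter> J = I \<or> I \<inter> J = J"
    using dyadic_blocks_cases[of I J] calculation assms by blast
  ultimately show "K \<in> m \<union> m'" by auto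
qed

lemma sum_common_refinement_le:
  fixes f :: "nat set \<Rightarrow> real"
  assumes "m \<subseteq> dyadic_blocks" "m' \<subseteq> dyadic_blocks" "finite m" "finite m'" "\<And>I. 0 \<le> f I"
  shows "sum f (common_refinement m m') \<le> sum f m + sum f m'"
proof -
  have "sum f (common_refinement m m') \<le> sum f (m \<union> m')"
    using assms common_refinement_dyadic by (intro sum_mono2) auto
  also have "\<dots> \<le> sum f m + sum f m'"
    using assms by (simp add: sum_Un_nat sum_Un sum_nonneg)
  finally show ?thesis .
qed

section \<open>Exponential moments of the projected noise\<close>

lemma sum_of_bool_eq_mult:
  fixes f :: "nat \<Rightarrow> real"
  assumes "finite A" "l \<in> A"
  shows "(\<Sum>j\<in>A. f j * of_bool (l = j)) = f l" "(\<Sum>j\<in>A. of_bool (l = j) :: real) = 1"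
proof -
  have "(\<Sum>j\<in>A. f j * of_bool (l = j)) = (\<Sum>j\<in>A. if j = l then f j else 0)"
    by (intro sum.cong) auto
  then show "(\<Sum>j\<in>A. f j * of_bool (l = j)) = f l" using assms by simp
  have "(\<Sum>j\<in>A. of_bool (l = j) :: real) = (\<Sum>j\<in>A. if j = l then 1 else 0)"
    by (intro sum.cong) auto
  then show "(\<Sum>j\<in>A. of_bool (l = j) :: real) = 1" using assms by simp
qed

text \<open>In |u + e_l - p|^2 the quadratic part of the increment is at most 2, and the linear part
  2 (u_l - E u) is centred with |u_l| \<le> |u|, so Hoeffding's lemma bounds its exponential moment.
  The price is a denominator lowered from A to A - 2.\<close>

lemma exp_sq_norm_add_centered_le:
  fixes p :: "nat pmf" and u :: "nat \<Rightarrow> real" and A :: real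
  assumes p: "set_pmf p \<subseteq> {1..r}" and A: "2 < A"
  shows "(\<integral>\<^sup>+ l. ennreal (exp ((\<Sum>j\<in>{1..r}. (u j + (of_bool (l = j) - pmf p j))\<^sup>2) / A)) \<partial>measure_pmf p)
    \<le> ennreal (exp (2 / A + (\<Sum>j\<in>{1..r}. (u j)\<^sup>2) / (A - 2)))"
proof -
  define U where "U = (\<Sum>j\<in>{1..r}. (u j)\<^sup>2)"
  have U0: "0 \<le> U" by (simp add: U_def sum_nonneg)
  define E where "E = measure_pmf.expectation p u"
  have E: "E = (\<Sum>j\<in>{1..r}. u j * pmf p j)"
    unfolding E_def by (rule integral_measure_pmf_real) (use p in auto)
  have pmf1: "(\<Sum>j\<in>{1..r}. pmf p j) = 1"
    using p by (intro sum_pmf_eq_1) auto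
  have bnd: "\<bar>u l\<bar> \<le> sqrt U" if "l \<in> {1..r}" for l
  proof -
    have "(u l)\<^sup>2 \<le> U" unfolding U_def using that by (intro member_le_sum) auto
    then have "sqrt ((u l)\<^sup>2) \<le> sqrt U" by (rule real_sqrt_le_mono)
    then show ?thesis by simp
  qed
  have AE: "AE l in measure_pmf p. u l \<in> {- sqrt U..sqrt U}"
  proof (subst AE_measure_pmf_iff, rule ballI)
    fix l assume "l \<in> set_pmf p"
    then have "\<bar>u l\<bar> \<le> sqrt U" using p bnd by blast
    then show "u l \<in> {- sqrt U..sqrt U}" by (simp add: abs_le_iff)
  qed
  interpret interval_bounded_random_variable "measure_pmf p" u "- sqrt U" "sqrt U"
    by unfold_locales (use AE in simp_all)
  have "(\<integral>\<^sup>+ l. ennreal (exp ((\<Sum>j\<in>{1..r}. (u j + (of_bool (l = j) - pmf p j))\<^sup>2) / A)) \<partial>measure_pmf p)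
      \<le> (\<integral>\<^sup>+ l. ennreal (exp (2 / A + U / A)) * ennreal (exp (2 / A * (u l - E))) \<partial>measure_pmf p)"
  proof (intro nn_integral_mono_AE)
    have "exp ((\<Sum>j\<in>{1..r}. (u j + (of_bool (l = j) - pmf p j))\<^sup>2) / A)
        \<le> exp (2 / A + U / A) * exp (2 / A * (u l - E))" if "l \<in> set_pmf p" for l
    proof -
      have l: "l \<in> {1..r}" using that p by auto
      have "(\<Sum>j\<in>{1..r}. (u j + (of_bool (l = j) - pmf p j))\<^sup>2)
          \<le> (\<Sum>j\<in>{1..r}. (u j)\<^sup>2 + 2 * (u j * of_bool (l = j)) - 2 * (u j * pmf p j)
                 + (of_bool (l = j) + pmf p j))"
      proof (intro sum_mono)
        fix j
        have "(of_bool (l = j) - pmf p j)\<^sup>2 \<le> of_bool (l = j) + pmf p j"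
        proof -
          have "pmf p j * pmf p j \<le> pmf p j" "0 \<le> pmf p j"
            by (simp_all add: pmf_le_1 mult_left_le)
          moreover have "(1 - pmf p j)\<^sup>2 = 1 - 2 * pmf p j + pmf p j * pmf p j"
            by (simp add: power2_diff, simp add: power2_eq_square)
          ultimately have "(1 - pmf p j)\<^sup>2 \<le> 1 + pmf p j" "(pmf p j)\<^sup>2 \<le> pmf p j"
            by (linarith, simp add: power2_eq_square)
          then show ?thesis by (cases "l = j") auto
        qed
        then show "(u j + (of_bool (l = j) - pmf p j))\<^sup>2
            \<le> (u j)\<^sup>2 + 2 * (u j * of_bool (l = j)) - 2 * (u j * pmf p j) + (of_bool (l = j) + pmf p j)"
          unfolding power2_sum[of "u j"] by (simp add: right_diff_distrib)
      qed
      also have "\<dots> = U + 2 * (u l - E) + 2"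
        using sum_of_bool_eq_mult[OF _ l] pmf1
        by (simp add: sum.distrib sum_subtractf U_def E sum_distrib_left[symmetric])
      finally have "(\<Sum>j\<in>{1..r}. (u j + (of_bool (l = j) - pmf p j))\<^sup>2) / A
          \<le> (U + 2 * (u l - E) + 2) / A"
        using A by (intro divide_right_mono) auto
      also have "\<dots> = (2 / A + U / A) + 2 / A * (u l - E)" by (simp add: add_divide_distrib)
      finally show ?thesis by (simp add: exp_add[symmetric])
    qed
    then show "AE l in measure_pmf p. ennreal (exp ((\<Sum>j\<in>{1..r}. (u j + (of_bool (l = j) - pmf p j))\<^sup>2) / A))
        \<le> ennreal (exp (2 / A + U / A)) * ennreal (exp (2 / A * (u l - E)))"
      by (auto simp: AE_measure_pmf_iff ennreal_mult[symmetric] intro!: ennreal_leI)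
  qed
  also have "\<dots> = ennreal (exp (2 / A + U / A)) * (\<integral>\<^sup>+ l. ennreal (exp (2 / A * (u l - E))) \<partial>measure_pmf p)"
    by (rule nn_integral_cmult) simp
  \<comment> \<open>The values of u lie in an interval of length 2 sqrt U, so Hoeffding's lemma
    contributes (2/A)^2 (4U) / 8 = 2U / A^2.\<close>
  also have "\<dots> \<le> ennreal (exp (2 / A + U / A)) * ennreal (exp ((2 / A)\<^sup>2 * (sqrt U - (- sqrt U))\<^sup>2 / 8))"
    using Hoeffdings_lemma_nn_integral[of "2 / A"] A by (intro mult_left_mono) (auto simp: E_def)
  also have "\<dots> = ennreal (exp (2 / A + U * (1 / A + 2 / A\<^sup>2)))"
    using U0 by (simp add: ennreal_mult[symmetric] exp_add[symmetric] power2_eq_square algebra_simps)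
  also have "\<dots> \<le> ennreal (exp (2 / A + U * (1 / (A - 2))))"
  proof -
    \<comment> \<open>Equivalent to (A + 2)(A - 2) \<le> A^2; this fixes the shift of the
      denominator at 2.\<close>
    have "1 / A + 2 / A\<^sup>2 \<le> 1 / (A - 2)"
      using A by (simp add: power2_eq_square divide_simps) (simp add: algebra_simps)
    then have "U * (1 / A + 2 / A\<^sup>2) \<le> U * (1 / (A - 2))" using U0 by (intro mult_left_mono)
    then show ?thesis by (intro ennreal_leI) simp
  qed
  finally show ?thesis by (simp add: U_def)
qed

definition noise :: "(nat \<Rightarrow> nat pmf) \<Rightarrow> (nat \<Rightarrow> nat) \<Rightarrow> rmat" where
  "noise P y = (\<lambda>l i. of_bool (y i = l) - pmf (P i) l)"

text \<open>
  The denominators grow by 2 with each coordinate that has entered the sum: this compensates the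
  factor lost in each application of the preceding one-step bound.
\<close>

lemma exp_noise_energy_partial_le:
  fixes P :: "nat \<Rightarrow> nat pmf"
  assumes "finite T" and P: "\<And>i. i \<in> T \<Longrightarrow> set_pmf (P i) \<subseteq> {1..r}"
    and F: "finite F" "disjoint F" "\<And>B. B \<in> F \<Longrightarrow> finite B \<and> B \<noteq> {}"
  shows "(\<integral>\<^sup>+ y. ennreal (exp (\<Sum>B\<in>F. (\<Sum>l\<in>{1..r}. (\<Sum>i\<in>B \<inter> T. noise P y l i)\<^sup>2)
            / (real (card B) + 2 * real (card (B \<inter> T))))) \<partial>measure_pmf (Pi_pmf T d P))
    \<le> ennreal (exp (\<Sum>B\<in>F. 2 * real (card (B \<inter> T)) / real (card B)))"
  using assms(1) P
proof (induction T rule: finite_induct)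
  case empty
  show ?case by simp
next
  case (insert x T)
  define h where "h B T y = (\<Sum>l\<in>{1..r}. (\<Sum>i\<in>B \<inter> T. noise P y l i)\<^sup>2)
            / (real (card B) + 2 * real (card (B \<inter> T)))" for B T y
  have IH: "(\<integral>\<^sup>+ y. ennreal (exp (\<Sum>B\<in>F. h B T y)) \<partial>measure_pmf (Pi_pmf T d P))
    \<le> ennreal (exp (\<Sum>B\<in>F. 2 * real (card (B \<inter> T)) / real (card B)))"
    unfolding h_def by (rule insert.IH) (use insert.prems in auto)
  have upd: "(\<Sum>i\<in>B \<inter> T. noise P (f(x := a)) l i) = (\<Sum>i\<in>B \<inter> T. noise P f l i)" for B f a l
    using insert.hyps by (intro sum.cong) (auto simp: noise_def)
  have h_notin: "h B (insert x T) (f(x := a)) = h B T f" if "x \<notin> B" for B f a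
    using that upd by (simp add: h_def)
  have eq: "(\<integral>\<^sup>+ y. ennreal (exp (\<Sum>B\<in>F. h B (insert x T) y)) \<partial>measure_pmf (Pi_pmf (insert x T) d P))
      = (\<integral>\<^sup>+ f. \<integral>\<^sup>+ a. ennreal (exp (\<Sum>B\<in>F. h B (insert x T) (f(x := a))))
            \<partial>measure_pmf (P x) \<partial>measure_pmf (Pi_pmf T d P))"
    using insert.hyps
    by (subst Pi_pmf_insert, simp, simp, subst pair_commute_pmf)
       (simp add: nn_integral_pair_pmf' case_prod_unfold map_pmf_comp)
  have "(\<integral>\<^sup>+ y. ennreal (exp (\<Sum>B\<in>F. h B (insert x T) y)) \<partial>measure_pmf (Pi_pmf (insert x T) d P))
      \<le> ennreal (exp (\<Sum>B\<in>F. 2 * real (card (B \<inter> insert x T)) / real (card B)))"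
  \<comment> \<open>The blocks are disjoint, so the new coordinate x enters at most one of them, and
    only the term of that block changes.\<close>
  proof (cases "\<exists>B\<in>F. x \<in> B")
    case False
    then have "(\<Sum>B\<in>F. h B (insert x T) (f(x := a))) = (\<Sum>B\<in>F. h B T f)" for f a
      using h_notin by (intro sum.cong) auto
    moreover have "(\<Sum>B\<in>F. 2 * real (card (B \<inter> insert x T)) / real (card B))
        = (\<Sum>B\<in>F. 2 * real (card (B \<inter> T)) / real (card B))"
      using False by (intro sum.cong) auto
    ultimately show ?thesis using IH unfolding eq by simp
  next
    case True
    then obtain C where C: "C \<in> F" "x \<in> C" by auto
    have other: "x \<notin> B" if "B \<in> F - {C}" for B
      using that C F(2) by (auto simp: disjoint_def)
    have finC: "finite C" "0 < card C" using F(3)[OF C(1)] by auto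
    have cardC: "card (C \<inter> insert x T) = Suc (card (C \<inter> T))"
      using C(2) insert.hyps finC by (simp add: Int_insert_right)
    define A where "A = real (card C) + 2 * real (card (C \<inter> insert x T))"
    have A: "2 < A" "A - 2 = real (card C) + 2 * real (card (C \<inter> T))" "real (card C) \<le> A"
      using finC by (auto simp: A_def cardC)
    have split: "(\<Sum>B\<in>F. h B (insert x T) (f(x := a)))
        = (\<Sum>B\<in>F - {C}. h B T f) + (\<Sum>l\<in>{1..r}. ((\<Sum>i\<in>C \<inter> T. noise P f l i)
             + (of_bool (a = l) - pmf (P x) l))\<^sup>2) / A" for f a
    proof -
      have "(\<Sum>i\<in>C \<inter> insert x T. noise P (f(x := a)) l i) = (\<Sum>i\<in>C \<inter> T. noise P f l i)
             + (of_bool (a = l) - pmf (P x) l)" for l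
        using C(2) insert.hyps upd by (simp add: Int_insert_right) (simp add: noise_def)
      then have "h C (insert x T) (f(x := a)) = (\<Sum>l\<in>{1..r}. ((\<Sum>i\<in>C \<inter> T. noise P f l i)
             + (of_bool (a = l) - pmf (P x) l))\<^sup>2) / A"
        by (simp add: h_def A_def)
      moreover have "(\<Sum>B\<in>F - {C}. h B (insert x T) (f(x := a))) = (\<Sum>B\<in>F - {C}. h B T f)"
        using other h_notin by (intro sum.cong) auto
      ultimately show ?thesis using sum.remove[OF F(1) C(1), of "\<lambda>B. h B (insert x T) (f(x := a))"]
        by simp
    qed
    have "(\<integral>\<^sup>+ y. ennreal (exp (\<Sum>B\<in>F. h B (insert x T) y)) \<partial>measure_pmf (Pi_pmf (insert x T) d P))
        = (\<integral>\<^sup>+ f. ennreal (exp (\<Sum>B\<in>F - {C}. h B T f)) *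
            (\<integral>\<^sup>+ a. ennreal (exp ((\<Sum>l\<in>{1..r}. ((\<Sum>i\<in>C \<inter> T. noise P f l i)
             + (of_bool (a = l) - pmf (P x) l))\<^sup>2) / A)) \<partial>measure_pmf (P x))
            \<partial>measure_pmf (Pi_pmf T d P))"
      unfolding eq split exp_add by (simp add: ennreal_mult nn_integral_cmult)
    also have "\<dots> \<le> (\<integral>\<^sup>+ f. ennreal (exp (\<Sum>B\<in>F - {C}. h B T f)) *
            ennreal (exp (2 / A + (\<Sum>l\<in>{1..r}. (\<Sum>i\<in>C \<inter> T. noise P f l i)\<^sup>2) / (A - 2)))
            \<partial>measure_pmf (Pi_pmf T d P))"
      by (intro nn_integral_mono mult_left_mono exp_sq_norm_add_centered_le A) (use insert.prems in auto)
    also have "\<dots> = (\<integral>\<^sup>+ f. ennreal (exp (2 / A)) * ennreal (exp (\<Sum>B\<in>F. h B T f))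
            \<partial>measure_pmf (Pi_pmf T d P))"
      using sum.remove[OF F(1) C(1), of "\<lambda>B. h B T _"]
      by (simp add: ennreal_mult[symmetric] exp_add[symmetric] h_def A(2) add_ac)
    also have "\<dots> = ennreal (exp (2 / A)) * (\<integral>\<^sup>+ f. ennreal (exp (\<Sum>B\<in>F. h B T f))
            \<partial>measure_pmf (Pi_pmf T d P))"
      by (rule nn_integral_cmult) simp
    also have "\<dots> \<le> ennreal (exp (2 / A)) * ennreal (exp (\<Sum>B\<in>F. 2 * real (card (B \<inter> T)) / real (card B)))"
      by (intro mult_left_mono IH) auto
    also have "\<dots> \<le> ennreal (exp (\<Sum>B\<in>F. 2 * real (card (B \<inter> insert x T)) / real (card B)))"
    proof -
      have "(\<Sum>B\<in>F - {C}. 2 * real (card (B \<inter> insert x T)) / real (card B))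
          = (\<Sum>B\<in>F - {C}. 2 * real (card (B \<inter> T)) / real (card B))"
        using other by (intro sum.cong) auto
      \<comment> \<open>Replacing A by the size of the block makes every coordinate cost the same,
        so a completely filled block costs 2.\<close>
      moreover have "2 / A \<le> 2 / real (card C)"
        using A finC by (intro divide_left_mono) auto
      ultimately have "2 / A + (\<Sum>B\<in>F. 2 * real (card (B \<inter> T)) / real (card B))
          \<le> (\<Sum>B\<in>F. 2 * real (card (B \<inter> insert x T)) / real (card B))"
        unfolding sum.remove[OF F(1) C(1)] cardC by (simp add: add_divide_distrib)
      then show ?thesis by (simp add: ennreal_mult[symmetric] exp_add[symmetric])
    qed
    finally show ?thesis .
  qed
  then show ?case by (simp add: h_def)
qed

text \<open>When all coordinates of a block are in, its denominator is three times its size, whence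
  the factor 1/3. The map g embeds the index range of a half into the columns of the whole sample,
  so even and odd columns are treated under the same product law.\<close>

lemma exp_noise_energy_le:
  fixes P :: "nat \<Rightarrow> nat pmf"
  assumes T: "finite T" and P: "\<And>i. i \<in> T \<Longrightarrow> set_pmf (P i) \<subseteq> {1..r}"
    and g: "inj_on g A" "g ` A \<subseteq> T" and m: "partition_on A m" "finite A"
  shows "(\<integral>\<^sup>+ y. ennreal (exp (\<Sum>I\<in>m. block_energy r (\<lambda>l i. noise P y l (g i)) I / 3))
        \<partial>measure_pmf (Pi_pmf T d P)) \<le> ennreal (exp (2 * real (card m)))"
proof -
  let ?F = "(`) g ` m"
  have sub: "I \<subseteq> A" if "I \<in> m" for I using m that by (auto simp: partition_on_def)
  have fin: "finite m" using m by (auto intro: finite_elements)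
  have injI: "inj_on g I" if "I \<in> m" for I using g(1) sub[OF that] by (rule inj_on_subset)
  have inj: "inj_on ((`) g) m"
    using sub by (intro inj_onI) (metis inj_on_image_eq_iff[OF g(1)])
  have int: "g ` I \<inter> T = g ` I" if "I \<in> m" for I using sub[OF that] g(2) by auto
  have F: "disjoint ?F"
  proof (rule disjointI)
    fix a b assume "a \<in> ?F" "b \<in> ?F" "a \<noteq> b"
    then obtain I J where IJ: "I \<in> m" "J \<in> m" "a = g ` I" "b = g ` J" "I \<noteq> J" by auto
    then have "I \<inter> J = {}" using m(1) by (auto simp: partition_on_def disjoint_def)
    then show "a \<inter> b = {}"
      using IJ sub inj_on_image_Int[OF g(1), of I J] by auto
  qed
  have ne: "\<And>B. B \<in> ?F \<Longrightarrow> finite B \<and> B \<noteq> {}"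
    using partition_on_finite_members[OF m] by auto
  have lhs: "(\<Sum>B\<in>?F. (\<Sum>l\<in>{1..r}. (\<Sum>i\<in>B \<inter> T. noise P y l i)\<^sup>2) / (real (card B) + 2 * real (card (B \<inter> T))))
      = (\<Sum>I\<in>m. block_energy r (\<lambda>l i. noise P y l (g i)) I / 3)" for y
    using inj injI int
    by (subst sum.reindex) (auto intro!: sum.cong simp: block_energy_def sum.reindex card_image)
  have rhs: "(\<Sum>B\<in>?F. 2 * real (card (B \<inter> T)) / real (card B)) = 2 * real (card m)"
  proof -
    have "(\<Sum>B\<in>?F. 2 * real (card (B \<inter> T)) / real (card B)) = (\<Sum>I\<in>m. 2)"
      using inj injI int partition_on_finite_members[OF m]
      by (subst sum.reindex) (auto intro!: sum.cong simp: card_image)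
    then show ?thesis by simp
  qed
  have "(\<integral>\<^sup>+ y. ennreal (exp (\<Sum>B\<in>?F. (\<Sum>l\<in>{1..r}. (\<Sum>i\<in>B \<inter> T. noise P y l i)\<^sup>2)
            / (real (card B) + 2 * real (card (B \<inter> T))))) \<partial>measure_pmf (Pi_pmf T d P))
    \<le> ennreal (exp (\<Sum>B\<in>?F. 2 * real (card (B \<inter> T)) / real (card B)))"
    by (rule exp_noise_energy_partial_le[OF T P _ F ne]) (use fin in auto)
  then show ?thesis unfolding lhs rhs .
qed

text \<open>A soft maximum, over all dyadic partitions, of a third of the energy minus 4 |m|. Of the
  4, one half pays for the exponential moment and the other makes the sum over m bounded uniformly
  in h.\<close>

definition noise_excess :: "nat \<Rightarrow> nat \<Rightarrow> rmat \<Rightarrow> real" where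
  "noise_excess r h z = (\<Sum>m\<in>dyadic_block_partitions h 0.
     exp ((\<Sum>I\<in>m. block_energy r z I / 3) - 4 * real (card m)))"

lemma noise_excess_nonneg: "0 \<le> noise_excess r h z"
  by (simp add: noise_excess_def sum_nonneg)

text \<open>From v \<le> exp v, and one term being at most the whole sum; hence the bound holds for
  all m simultaneously, also for an m selected from the data.\<close>

lemma energy_le_noise_excess:
  assumes "m \<in> dyadic_block_partitions h 0"
  shows "(\<Sum>I\<in>m. block_energy r z I) \<le> 12 * real (card m) + 3 * noise_excess r h z"
proof -
  let ?v = "(\<Sum>I\<in>m. block_energy r z I / 3) - 4 * real (card m)"
  have "?v \<le> exp ?v" using exp_ge_add_one_self[of ?v] by linarith
  also have "\<dots> \<le> noise_excess r h z"
    unfolding noise_excess_def using assms by (intro member_le_sum) auto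
  finally show ?thesis by (simp add: sum_divide_distrib[symmetric])
qed

lemma expectation_noise_excess_le:
  fixes P :: "nat \<Rightarrow> nat pmf"
  assumes T: "finite T" and P: "\<And>i. i \<in> T \<Longrightarrow> set_pmf (P i) \<subseteq> {1..r}"
    and g: "inj_on g {1..2 ^ h}" "g ` {1..2 ^ h} \<subseteq> T"
  shows "(\<integral>\<^sup>+ y. ennreal (noise_excess r h (\<lambda>l i. noise P y l (g i))) \<partial>measure_pmf (Pi_pmf T d P)) \<le> 1"
proof -
  let ?D = "dyadic_block_partitions h 0"
  have "(\<integral>\<^sup>+ y. ennreal (noise_excess r h (\<lambda>l i. noise P y l (g i))) \<partial>measure_pmf (Pi_pmf T d P))
    = (\<Sum>m\<in>?D. \<integral>\<^sup>+ y. ennreal (exp (- 4 * real (card m))) *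
          ennreal (exp (\<Sum>I\<in>m. block_energy r (\<lambda>l i. noise P y l (g i)) I / 3)) \<partial>measure_pmf (Pi_pmf T d P))"
  proof (subst nn_integral_sum[symmetric])
    have "ennreal (noise_excess r h z) = (\<Sum>m\<in>?D. ennreal (exp (- 4 * real (card m))) *
          ennreal (exp (\<Sum>I\<in>m. block_energy r z I / 3)))" for z
      unfolding noise_excess_def
      by (subst sum_ennreal[symmetric]) (simp_all add: ennreal_mult[symmetric] exp_add[symmetric])
    then show "(\<integral>\<^sup>+ y. ennreal (noise_excess r h (\<lambda>l i. noise P y l (g i))) \<partial>measure_pmf (Pi_pmf T d P))
      = (\<integral>\<^sup>+ y. (\<Sum>m\<in>?D. ennreal (exp (- 4 * real (card m))) *
          ennreal (exp (\<Sum>I\<in>m. block_energy r (\<lambda>l i. noise P y l (g i)) I / 3))) \<partial>measure_pmf (Pi_pmf T d P))"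
      by simp
  qed simp
  also have "\<dots> \<le> (\<Sum>m\<in>?D. ennreal ((1 / 4) ^ card m))"
  proof (intro sum_mono)
    fix m assume m: "m \<in> ?D"
    then have part: "partition_on {1..2 ^ h} m" by (simp add: dyadic_block_partitions_def blk_def)
    have "(\<integral>\<^sup>+ y. ennreal (exp (- 4 * real (card m))) *
          ennreal (exp (\<Sum>I\<in>m. block_energy r (\<lambda>l i. noise P y l (g i)) I / 3)) \<partial>measure_pmf (Pi_pmf T d P))
      \<le> ennreal (exp (- 4 * real (card m))) * ennreal (exp (2 * real (card m)))"
      by (subst nn_integral_cmult) (auto intro!: mult_left_mono exp_noise_energy_le[OF T P g part])
    also have "\<dots> = ennreal (exp (- 2) ^ card m)"
      by (simp add: ennreal_mult[symmetric] exp_add[symmetric] exp_of_nat_mult[symmetric] algebra_simps)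
    also have "\<dots> \<le> ennreal ((1 / 4) ^ card m)"
    proof -
      \<comment> \<open>e \<ge> 2 brings the remaining factor exp (-2) per piece below the summable
        weight 1/4.\<close>
      have "2 * 2 \<le> exp 1 * exp (1 :: real)" using exp_ge_add_one_self[of 1] by (intro mult_mono) auto
      then have "4 \<le> exp (2 :: real)" by (simp add: exp_add[symmetric])
      then have "exp (- 2) \<le> (1 / 4 :: real)" by (simp add: exp_minus field_simps)
      then show ?thesis by (intro ennreal_leI power_mono) auto
    qed
    finally show "(\<integral>\<^sup>+ y. ennreal (exp (- 4 * real (card m))) *
          ennreal (exp (\<Sum>I\<in>m. block_energy r (\<lambda>l i. noise P y l (g i)) I / 3)) \<partial>measure_pmf (Pi_pmf T d P))
      \<le> ennreal ((1 / 4) ^ card m)" .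
  qed
  also have "\<dots> = ennreal (\<Sum>m\<in>?D. (1 / 4) ^ card m)" by (simp add: sum_ennreal)
  also have "\<dots> \<le> ennreal 1" using sum_dyadic_block_partitions_le[of h 0] by (intro ennreal_leI) linarith
  finally show ?thesis by simp
qed

section \<open>Approximation of Besov bodies on adapted partitions\<close>

text \<open>Squared distance from the columns of t in I to the matrices constant on I, in the form
  whose change under halving I is easy to compute.\<close>

definition scatter :: "nat \<Rightarrow> rmat \<Rightarrow> nat set \<Rightarrow> real" where
  "scatter r t I = (\<Sum>l\<in>{1..r}. (\<Sum>i\<in>I. (t l i)\<^sup>2) - (\<Sum>i\<in>I. t l i)\<^sup>2 / real (card I))"

lemma sum_sq_diff_const:
  fixes f :: "nat \<Rightarrow> real"
  assumes "finite I" "I \<noteq> {}"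
  shows "(\<Sum>i\<in>I. (f i - c)\<^sup>2) = (\<Sum>i\<in>I. (f i)\<^sup>2) - (\<Sum>i\<in>I. f i)\<^sup>2 / real (card I)
    + real (card I) * (c - (\<Sum>i\<in>I. f i) / real (card I))\<^sup>2"
proof -
  have "0 < real (card I)" using assms by (simp add: card_gt_0_iff)
  then have "real (card I) * (c - (\<Sum>i\<in>I. f i) / real (card I))\<^sup>2 - (\<Sum>i\<in>I. f i)\<^sup>2 / real (card I)
      = real (card I) * c\<^sup>2 - 2 * c * (\<Sum>i\<in>I. f i)"
    by (simp add: power2_eq_square field_simps)
  moreover have "(\<Sum>i\<in>I. (f i - c)\<^sup>2) = (\<Sum>i\<in>I. (f i)\<^sup>2) + (real (card I) * c\<^sup>2 - 2 * c * (\<Sum>i\<in>I. f i))"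
    by (simp add: power2_diff sum.distrib sum_subtractf sum_distrib_left sum_distrib_right algebra_simps)
  ultimately show ?thesis by simp
qed

lemma mnorm_diff_block_mean:
  assumes m: "partition_on {1..q} m"
  shows "(mnorm r q (t - block_mean r m t))\<^sup>2 = (\<Sum>I\<in>m. scatter r t I)"
proof -
  have "(\<Sum>i\<in>I. ((t - block_mean r m t) l i)\<^sup>2) = (\<Sum>i\<in>I. (t l i)\<^sup>2) - (\<Sum>i\<in>I. t l i)\<^sup>2 / real (card I)"
    if "l \<in> {1..r}" "I \<in> m" for l I
    using sum_sq_diff_const[OF partition_on_finite_members(1,2)[OF m finite_atLeastAtMost that(2)],
        of "t l" "(\<Sum>i\<in>I. t l i) / real (card I)"] block_mean_eq[OF m that]
    by simp
  then show ?thesis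
    unfolding mnorm_sq scatter_def sum_partition_on[OF m finite_atLeastAtMost]
    by (subst (2) sum.swap) simp
qed

text \<open>The mean over the long block is a competitor on the short one, and the columns 2i with i
  in the short block all lie in the long block.\<close>

lemma scatter_even_cols_le:
  assumes "0 < L"
  shows "scatter r (even_cols t) (blk L k) \<le> scatter r t (blk (2 * L) k)"
  unfolding scatter_def
proof (rule sum_mono)
  fix l
  define c where "c = (\<Sum>i\<in>blk (2 * L) k. t l i) / real (card (blk (2 * L) k))"
  have "(\<Sum>i\<in>blk L k. (even_cols t l i)\<^sup>2) - (\<Sum>i\<in>blk L k. even_cols t l i)\<^sup>2 / real (card (blk L k))
      \<le> (\<Sum>i\<in>blk L k. (even_cols t l i - c)\<^sup>2)"
    using sum_sq_diff_const[of "blk L k" "even_cols t l" c] assms by simp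
  also have "\<dots> = (\<Sum>i\<in>(*) 2 ` blk L k. (t l i - c)\<^sup>2)"
    by (subst sum.reindex) (auto simp: even_cols_def inj_on_def)
  also have "\<dots> \<le> (\<Sum>i\<in>blk (2 * L) k. (t l i - c)\<^sup>2)"
    by (intro sum_mono2) (auto simp: blk_def)
  also have "\<dots> = (\<Sum>i\<in>blk (2 * L) k. (t l i)\<^sup>2) - (\<Sum>i\<in>blk (2 * L) k. t l i)\<^sup>2 / real (card (blk (2 * L) k))"
    using sum_sq_diff_const[of "blk (2 * L) k" "t l" c] assms by (simp add: c_def)
  finally show "(\<Sum>i\<in>blk L k. (even_cols t l i)\<^sup>2) - (\<Sum>i\<in>blk L k. even_cols t l i)\<^sup>2 / real (card (blk L k))
    \<le> (\<Sum>i\<in>blk (2 * L) k. (t l i)\<^sup>2) - (\<Sum>i\<in>blk (2 * L) k. t l i)\<^sup>2 / real (card (blk (2 * L) k))" .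
qed

section \<open>Haar coefficients and the energy tree\<close>

lemma haar_eq:
  assumes "j < N"
  shows "haar (2 ^ N) j k i = 2 powr (real j / 2) / sqrt (2 ^ N) *
    (indicator (blk (2 ^ (N - 1 - j)) (2 * k)) i - indicator (blk (2 ^ (N - 1 - j)) (2 * k + 1)) i)"
proof -
  define M :: nat where "M = 2 ^ (N - 1 - j)"
  have M: "0 < M" by (simp add: M_def)
  have "2 ^ j * (2 * M) = (2 :: nat) ^ N"
    using assms unfolding M_def by (simp add: power_add[symmetric] flip: power_Suc)
  then have "real (2 ^ j * (2 * M)) = real (2 ^ N)" by (rule arg_cong)
  then have N: "2 ^ N = 2 ^ j * (2 * real M)" by simp
  \<comment> \<open>Multiplying by 2M turns the comparisons of x with 0, 1/2 and 1 into comparisons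
    of integers. The left-open, right-closed pieces of \<open>haar_mother\<close> match blocks that
    begin at \<open>k * L + 1\<close>.\<close>
  define x where "x = 2 ^ j * (real i / real (2 ^ N)) - real k"
  have "x = real i / (2 * real M) - real k" unfolding x_def using N by simp
  then have x: "x * (2 * real M) = real i - real (2 * k * M)" using M by (simp add: field_simps)
  have "0 < x \<longleftrightarrow> 0 < x * (2 * real M)" using M by (simp add: zero_less_mult_iff)
  then have 1: "0 < x \<longleftrightarrow> 2 * k * M < i" unfolding x by linarith
  have "x \<le> 1 / 2 \<longleftrightarrow> x * (2 * real M) \<le> 1 / 2 * (2 * real M)"
    using M by (intro mult_le_cancel_right_pos[symmetric]) simp
  then have 2: "x \<le> 1 / 2 \<longleftrightarrow> i \<le> 2 * k * M + M"
    unfolding x of_nat_le_iff[where 'a = real, symmetric] of_nat_add of_nat_mult of_nat_numeral by linarith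
  have "x \<le> 1 \<longleftrightarrow> x * (2 * real M) \<le> 1 * (2 * real M)"
    using M by (intro mult_le_cancel_right_pos[symmetric]) simp
  then have 3: "x \<le> 1 \<longleftrightarrow> i \<le> 2 * k * M + 2 * M"
    unfolding x of_nat_le_iff[where 'a = real, symmetric] of_nat_add of_nat_mult of_nat_numeral by linarith
  have "haar_mother x = indicator (blk M (2 * k)) i - indicator (blk M (2 * k + 1)) i"
    unfolding haar_mother_def blk_def indicator_def using 1 2 3 by (auto simp: algebra_simps)
  then show ?thesis unfolding haar_def M_def[symmetric] x_def[symmetric] by simp
qed

lemma blk_subset_grid:
  assumes "j \<le> N" "k < 2 ^ j"
  shows "blk (2 ^ (N - j)) k \<subseteq> {1..2 ^ N}"
proof -
  have "(k + 1) * 2 ^ (N - j) \<le> 2 ^ j * 2 ^ (N - j)" using assms by (intro mult_right_mono) auto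
  also have "\<dots> = 2 ^ N" using assms by (simp add: power_add[symmetric])
  finally show ?thesis by (auto simp: blk_def)
qed

lemma haar_coeff_eq:
  assumes j: "j < N" and k: "k < 2 ^ j"
  shows "haar_coeff (2 ^ N) t j k l = 2 powr (real j / 2) / sqrt (2 ^ N) *
    ((\<Sum>i\<in>blk (2 ^ (N - 1 - j)) (2 * k). t l i) - (\<Sum>i\<in>blk (2 ^ (N - 1 - j)) (2 * k + 1). t l i))"
proof -
  let ?c = "2 powr (real j / 2) / sqrt (2 ^ N) :: real"
  have sub: "blk (2 ^ (N - 1 - j)) (2 * k) \<subseteq> {1..2 ^ N}" "blk (2 ^ (N - 1 - j)) (2 * k + 1) \<subseteq> {1..2 ^ N}"
    using blk_subset_grid[of "Suc j" N "2 * k"] blk_subset_grid[of "Suc j" N "2 * k + 1"] j k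
    by simp_all
  have ind: "(\<Sum>i\<in>{1..2 ^ N}. t l i * indicator B i) = (\<Sum>i\<in>B. t l i)" if "B \<subseteq> {1..2 ^ N}" for B
    using that sum.inter_restrict[of "{1..2 ^ N}" "t l" B]
    by (simp add: indicator_def Int_absorb1 if_distrib cong: if_cong)
  have "haar_coeff (2 ^ N) t j k l = (\<Sum>i\<in>{1..2 ^ N}. ?c *
    (t l i * indicator (blk (2 ^ (N - 1 - j)) (2 * k)) i - t l i * indicator (blk (2 ^ (N - 1 - j)) (2 * k + 1)) i))"
    unfolding haar_coeff_def haar_eq[OF j] by (intro sum.cong) (auto simp: algebra_simps)
  then show ?thesis
    unfolding sum_distrib_left[symmetric] sum_subtractf ind[OF sub(1)] ind[OF sub(2)] .
qed

definition haar_energy :: "nat \<Rightarrow> nat \<Rightarrow> rmat \<Rightarrow> nat \<Rightarrow> nat \<Rightarrow> real" where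
  "haar_energy r N t j k = (L2_set (haar_coeff (2 ^ N) t j k) {1..r})\<^sup>2"

text \<open>Pythagoras for one split: with sums a and b over halves of length M, the scatter drops
  by (a - b)^2 / (2M), and the Haar normalisation 2^j / 2^N = 1 / (2M) makes this the squared
  coefficient.\<close>

lemma scatter_split:
  assumes j: "j < N" and k: "k < 2 ^ j"
  shows "scatter r t (blk (2 ^ (N - j)) k) = haar_energy r N t j k
    + scatter r t (blk (2 ^ (N - Suc j)) (2 * k)) + scatter r t (blk (2 ^ (N - Suc j)) (2 * k + 1))"
proof -
  define M :: nat where "M = 2 ^ (N - 1 - j)"
  have M: "0 < M" and M1: "2 ^ (N - Suc j) = M" by (simp_all add: M_def)
  have M2: "2 ^ (N - j) = 2 * M" using j by (simp add: M_def Suc_diff_Suc flip: power_Suc)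
  have "real (2 ^ N) = real (2 ^ j * 2 ^ (N - j))" using j by (simp flip: power_add)
  then have N: "(2 :: real) ^ N = 2 ^ j * (2 * real M)" unfolding M2 by simp
  have c: "(2 powr (real j / 2) / sqrt (2 ^ N))\<^sup>2 = 1 / (2 * real M)"
  proof -
    have "(2 powr (real j / 2))\<^sup>2 = (2 :: real) ^ j"
      by (simp add: powr_power powr_realpow)
    then show ?thesis unfolding power_divide using M N by simp
  qed
  have "haar_energy r N t j k = (\<Sum>l\<in>{1..r}. (haar_coeff (2 ^ N) t j k l)\<^sup>2)"
    unfolding haar_energy_def L2_set_def by (simp add: sum_nonneg)
  also have "\<dots> = (\<Sum>l\<in>{1..r}. ((\<Sum>i\<in>blk M (2 * k). t l i) - (\<Sum>i\<in>blk M (2 * k + 1). t l i))\<^sup>2 / (2 * real M))"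
    unfolding haar_coeff_eq[OF j k] power_mult_distrib c M_def[symmetric] by simp
  finally have e: "haar_energy r N t j k = \<dots>" .
  have u: "sum f (blk (2 * M) k) = sum f (blk M (2 * k)) + sum f (blk M (2 * k + 1))" for f :: "nat \<Rightarrow> real"
    unfolding blk_split(1)[OF M] using blk_split(2)[OF M] by (intro sum.union_disjoint) auto
  have alg: "(A + B) - (a + b)\<^sup>2 / (2 * real M) = (a - b)\<^sup>2 / (2 * real M) + (A - a\<^sup>2 / real M) + (B - b\<^sup>2 / real M)"
    for a b A B :: real
    using M by (simp add: power2_eq_square field_simps)
  show ?thesis
    unfolding M1 M2 e scatter_def sum.distrib[symmetric] card_blk u
    using alg by (intro sum.cong) simp_all
qed

text \<open>The pairs (j, k) form the binary tree of Haar positions; the sum runs over d levels from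
  a node downwards, the node included. The general monoid lets real energies and natural counts
  share one recursion.\<close>

definition tree_sum :: "(nat \<Rightarrow> nat \<Rightarrow> 'a::comm_monoid_add) \<Rightarrow> nat \<Rightarrow> nat \<Rightarrow> nat \<Rightarrow> 'a" where
  "tree_sum F d j k = (\<Sum>i<d. \<Sum>l<2 ^ i. F (j + i) (k * 2 ^ i + l))"

lemma tree_sum_Suc:
  "tree_sum F (Suc d) j k = F j k + (tree_sum F d (Suc j) (2 * k) + tree_sum F d (Suc j) (2 * k + 1))"
proof -
  have dbl: "(\<Sum>l<2 * a. g l) = (\<Sum>l<a. g l) + (\<Sum>l<a. g (a + l))" for g :: "nat \<Rightarrow> 'a" and a :: nat
  proof -
    have "{..<2 * a} = {..<a} \<union> {a..<2 * a}" by auto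
    then have "(\<Sum>l<2 * a. g l) = (\<Sum>l<a. g l) + (\<Sum>l\<in>{a..<2 * a}. g l)"
      by (metis finite_atLeastLessThan finite_lessThan ivl_disj_int_one(2) sum.union_disjoint)
    also have "(\<Sum>l\<in>{a..<2 * a}. g l) = (\<Sum>l<a. g (a + l))"
      by (rule sum.reindex_bij_witness[of _ "\<lambda>l. a + l" "\<lambda>l. l - a"]) auto
    finally show ?thesis .
  qed
  have "(\<Sum>i<d. \<Sum>l<2 ^ Suc i. F (j + Suc i) (k * 2 ^ Suc i + l))
      = tree_sum F d (Suc j) (2 * k) + tree_sum F d (Suc j) (2 * k + 1)"
    unfolding tree_sum_def sum.distrib[symmetric] power_Suc dbl
    by (intro sum.cong refl arg_cong2[where f = "(+)"]) (simp_all add: algebra_simps)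
  then show ?thesis
    unfolding tree_sum_def by (subst sum.lessThan_Suc_shift) simp
qed

text \<open>Parseval on one block: splitting is iterated down to single columns, whose scatter
  vanishes.\<close>

lemma scatter_eq_tree_sum:
  assumes "j + d = N" "k < 2 ^ j"
  shows "scatter r t (blk (2 ^ d) k) = tree_sum (haar_energy r N t) d j k"
  using assms
proof (induction d arbitrary: j k)
  case 0
  have "blk 1 k = {k + 1}" by (auto simp: blk_def)
  then show ?case by (simp add: tree_sum_def scatter_def)
next
  case (Suc d)
  have "N - j = Suc d" "N - Suc j = d" using Suc.prems by auto
  then show ?case
    using scatter_split[of j N k r t] Suc.prems Suc.IH[of "Suc j" "2 * k"] Suc.IH[of "Suc j" "2 * k + 1"]
    by (simp add: tree_sum_Suc)
qed

text \<open>
  A block is split as long as a kept Haar coefficient lives on it, so that every kept coefficient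
  is responsible for at most one split per level.
\<close>

lemma adapted_partition_exists:
  fixes keep :: "nat \<Rightarrow> nat \<Rightarrow> bool"
  assumes "j + Suc d = N" "k < 2 ^ j"
  shows "\<exists>m. partition_on (blk (2 ^ d) k) m \<and> m \<subseteq> dyadic_intervals N
    \<and> (\<Sum>I\<in>m. scatter r (even_cols t) I)
       \<le> tree_sum (\<lambda>j k. if keep j k then 0 else haar_energy r N t j k) (Suc d) j k
    \<and> card m \<le> 1 + d * tree_sum (\<lambda>j k. of_bool (keep j k)) (Suc d) j k"
  using assms
proof (induction d arbitrary: j k)
  case 0
  \<comment> \<open>A block of length 1 in the half-size matrix stands for one of length 2 in the
    full matrix. It cannot be split, and its own Haar energy is mere slack; hence trees of depth
    \<open>Suc d\<close> but only d levels of splitting.\<close>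
  have b: "blk 1 k = {k + 1}" by (auto simp: blk_def)
  have "blk (2 ^ 0) k \<in> dyadic_intervals N"
    unfolding dyadic_intervals_alt using 0 by (intro CollectI exI[of _ j] exI[of _ k]) auto
  moreover have "partition_on (blk (2 ^ 0) k) {blk (2 ^ 0) k}"
    by (intro partition_on_space) simp
  moreover have "(\<Sum>I\<in>{blk (2 ^ 0) k}. scatter r (even_cols t) I) = 0"
    using b by (simp add: scatter_def)
  moreover have "0 \<le> tree_sum (\<lambda>j k. if keep j k then 0 else haar_energy r N t j k) (Suc 0) j k"
    unfolding tree_sum_def by (intro sum_nonneg) (auto simp: haar_energy_def)
  ultimately show ?case by (intro exI[of _ "{blk (2 ^ 0) k}"]) simp
next
  case (Suc d)
  let ?E = "\<lambda>j k. if keep j k then 0 else haar_energy r N t j k"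
  let ?K = "\<lambda>j k. of_bool (keep j k) :: nat"
  show ?case
  proof (cases "tree_sum ?K (Suc (Suc d)) j k = 0")
    case True
    then have "\<not> keep (j + i) (k * 2 ^ i + l)" if "i < Suc (Suc d)" "l < 2 ^ i" for i l
    proof -
      have "(\<Sum>l<2 ^ i. ?K (j + i) (k * 2 ^ i + l)) = 0"
        using True that(1) unfolding tree_sum_def by (subst (asm) sum_eq_0_iff) simp_all
      then have "?K (j + i) (k * 2 ^ i + l) = 0"
        using that(2) by (subst (asm) sum_eq_0_iff) simp_all
      then show ?thesis by simp
    qed
    \<comment> \<open>No coefficient is kept below this node, so the allowed bias is the full energy
      of the subtree, that is, the scatter of the block twice as long.\<close>
    then have "tree_sum ?E (Suc (Suc d)) j k = tree_sum (haar_energy r N t) (Suc (Suc d)) j k"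
      unfolding tree_sum_def by (intro sum.cong) auto
    also have "\<dots> = scatter r t (blk (2 ^ Suc (Suc d)) k)"
      using scatter_eq_tree_sum[of j "Suc (Suc d)" N k r t] Suc.prems by simp
    finally have "scatter r (even_cols t) (blk (2 ^ Suc d) k) \<le> tree_sum ?E (Suc (Suc d)) j k"
      using scatter_even_cols_le[of "2 ^ Suc d" r t k] by simp
    moreover have "blk (2 ^ Suc d) k \<in> dyadic_intervals N"
    proof -
      have "N - 1 - j = Suc d" "j \<le> N - 1" "k \<le> 2 ^ j - 1" using Suc.prems by auto
      then show ?thesis unfolding dyadic_intervals_alt by (metis (mono_tags, lifting) mem_Collect_eq)
    qed
    moreover have "partition_on (blk (2 ^ Suc d) k) {blk (2 ^ Suc d) k}"
      by (intro partition_on_space) simp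
    ultimately show ?thesis by (intro exI[of _ "{blk (2 ^ Suc d) k}"]) simp
  next
    case False
    have idx: "Suc j + Suc d = N" "2 * k < 2 ^ Suc j" "2 * k + 1 < 2 ^ Suc j"
      using Suc.prems by auto
    obtain a where
      a: "partition_on (blk (2 ^ d) (2 * k)) a" "a \<subseteq> dyadic_intervals N"
        "(\<Sum>I\<in>a. scatter r (even_cols t) I) \<le> tree_sum ?E (Suc d) (Suc j) (2 * k)"
        "card a \<le> 1 + d * tree_sum ?K (Suc d) (Suc j) (2 * k)"
      using Suc.IH[OF idx(1,2)] by (elim exE conjE) (rule that)
    obtain b where
      b: "partition_on (blk (2 ^ d) (2 * k + 1)) b" "b \<subseteq> dyadic_intervals N"
        "(\<Sum>I\<in>b. scatter r (even_cols t) I) \<le> tree_sum ?E (Suc d) (Suc j) (2 * k + 1)"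
        "card b \<le> 1 + d * tree_sum ?K (Suc d) (Suc j) (2 * k + 1)"
      using Suc.IH[OF idx(1,3)] by (elim exE conjE) (rule that)
    have B: "blk (2 ^ Suc d) k = blk (2 ^ d) (2 * k) \<union> blk (2 ^ d) (2 * k + 1)"
      "blk (2 ^ d) (2 * k) \<inter> blk (2 ^ d) (2 * k + 1) = {}"
      using blk_split[of "2 ^ d" k] by simp_all
    have ab: "x \<inter> y = {}" if "x \<in> a" "y \<in> b" for x y
    proof -
      have "x \<subseteq> blk (2 ^ d) (2 * k)" "y \<subseteq> blk (2 ^ d) (2 * k + 1)"
        using that a(1) b(1) by (auto simp: partition_on_def)
      then show ?thesis using B(2) by blast
    qed
    have ne: "{} \<notin> a" "{} \<notin> b" using a(1) b(1) by (auto simp: partition_on_def)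
    have disj: "a \<inter> b = {}" using ab ne by fastforce
    have fin: "finite a" "finite b"
      using finite_elements[OF finite_blk a(1)] finite_elements[OF finite_blk b(1)] .
    have part: "partition_on (blk (2 ^ Suc d) k) (a \<union> b)"
    proof (rule partition_onI)
      show "\<Union> (a \<union> b) = blk (2 ^ Suc d) k" using a(1) b(1) B(1) by (auto simp: partition_on_def)
      show "{} \<notin> a \<union> b" using ne by auto
      fix p q assume pq: "p \<in> a \<union> b" "q \<in> a \<union> b" "p \<noteq> q"
      have "disjoint a" "disjoint b" using a(1) b(1) by (auto simp: partition_on_def)
      then show "disjnt p q" unfolding disjnt_def disjoint_def
        using pq ab[of p q] ab[of q p] by blast
    qed
    have "0 \<le> ?E j k" by (simp add: haar_energy_def)
    then have E: "(\<Sum>I\<in>a \<union> b. scatter r (even_cols t) I) \<le> tree_sum ?E (Suc (Suc d)) j k"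
      unfolding tree_sum_Suc[of ?E "Suc d"] sum.union_disjoint[OF fin disj] using a(3) b(3) by linarith
    have "card (a \<union> b) \<le> card a + card b" by (rule card_Un_le)
    also have "\<dots> \<le> 2 + d * (tree_sum ?K (Suc d) (Suc j) (2 * k) + tree_sum ?K (Suc d) (Suc j) (2 * k + 1))"
      using a(4) b(4) by (simp add: algebra_simps)
    also have "\<dots> \<le> 2 + d * tree_sum ?K (Suc (Suc d)) j k"
      unfolding tree_sum_Suc[of ?K "Suc d"] by (intro add_left_mono mult_left_mono) auto
    \<comment> \<open>The subtree contains a kept coefficient, to which the additional piece is
      charged.\<close>
    also have "\<dots> \<le> 1 + Suc d * tree_sum ?K (Suc (Suc d)) j k" using False by simp
    finally show ?thesis using part E a(2) b(2) by (intro exI[of _ "a \<union> b"]) auto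
  qed
qed

lemma atLeast0AtMost_minus_one: "0 < n \<Longrightarrow> {0..n - 1} = {..<n :: nat}"
  by auto

lemma besov_levels_le:
  assumes t: "t \<in> besov_body r N \<alpha> p R" and p: "0 < p" and N: "1 \<le> N"
  shows "(\<Sum>j<N. 2 powr (real j * p * (\<alpha> + 1 / 2 - 1 / p)) *
      (\<Sum>k<2 ^ j. (L2_set (haar_coeff (2 ^ N) t j k) {1..r}) powr p)) \<le> (sqrt (2 ^ N) * R) powr p"
proof -
  let ?S = "\<Sum>j<N. 2 powr (real j * p * (\<alpha> + 1 / 2 - 1 / p)) *
      (\<Sum>k<2 ^ j. (L2_set (haar_coeff (2 ^ N) t j k) {1..r}) powr p)"
  have sets: "{0..N - 1} = {..<N}" "\<And>j. {0..2 ^ j - 1} = {..<2 ^ j :: nat}"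
    by (rule atLeast0AtMost_minus_one, use N in simp)+
  have "?S powr (1 / p) \<le> sqrt (2 ^ N) * R"
    using t unfolding besov_body_def Let_def sets by simp
  then have "(?S powr (1 / p)) powr p \<le> (sqrt (2 ^ N) * R) powr p"
    using p by (intro powr_mono2) auto
  moreover have "0 \<le> ?S" by (intro sum_nonneg mult_nonneg_nonneg) auto
  ultimately show ?thesis using p by (simp add: powr_powr)
qed

lemma sum_two_power_le:
  assumes "1 \<le> (\<rho> :: real)"
  shows "(\<Sum>j<N. if 2 ^ j \<le> \<rho> then 2 ^ j else 0) \<le> 2 * \<rho>"
proof -
  \<comment> \<open>The bound by 2^N strengthens the induction: if 2^N \<le> \<rho>, adding 2^N to a
    sum already below 2^N stays below 2\<rho>.\<close>
  have "(\<Sum>j<N. if 2 ^ j \<le> \<rho> then 2 ^ j else 0) \<le> 2 * \<rho> \<and>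
    (\<Sum>j<N. if 2 ^ j \<le> \<rho> then 2 ^ j else 0) \<le> (2 :: real) ^ N"
    by (induction N) (use assms in auto)
  then show ?thesis by simp
qed

text \<open>On levels with 2^j > \<rho> the Besov weights are at least \<rho>^(p \<gamma>), where
  \<gamma> > 0 is the condition on \<alpha>, so the unweighted p-th powers there sum to at most
  \<rho>. This tail bounds the bias and the number of fine coefficients kept; the coarse levels add
  at most 2\<rho> to the count.\<close>

lemma besov_approximation:
  fixes \<alpha> p R :: real and N :: nat
  defines "\<rho> \<equiv> (sqrt (2 ^ N) * R) powr (2 / (2 * \<alpha> + 1))"
  assumes t: "t \<in> besov_body r N \<alpha> p R" and p: "0 < p" "p \<le> 2" and \<alpha>: "1 / p - 1 / 2 < \<alpha>"
    and N: "1 \<le> N" and R: "1 \<le> sqrt (2 ^ N) * R"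
  shows "\<exists>m \<in> dyadic_partitions N.
    (mnorm r (2 ^ (N - 1)) (even_cols t - block_mean r m (even_cols t)))\<^sup>2 \<le> \<rho> \<and> real (card m) \<le> 1 + 3 * real N * \<rho>"
proof -
  define \<gamma> where "\<gamma> = \<alpha> + 1 / 2 - 1 / p"
  have \<gamma>: "0 < \<gamma>" using \<alpha> by (simp add: \<gamma>_def)
  have \<alpha>0: "0 < \<alpha>"
  proof -
    have "1 / 2 \<le> 1 / p" using p by (simp add: field_simps)
    then show ?thesis using \<alpha> by linarith
  qed
  have \<rho>1: "1 \<le> \<rho>" unfolding \<rho>_def using R \<alpha>0 by (intro ge_one_powr_ge_zero) auto
  have \<rho>p: "\<rho> powr (p * (\<alpha> + 1 / 2)) = (sqrt (2 ^ N) * R) powr p"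
  proof -
    have "2 / (2 * \<alpha> + 1) * (p * (\<alpha> + 1 / 2)) = p" using \<alpha>0 by (simp add: field_simps)
    then show ?thesis unfolding \<rho>_def powr_powr by simp
  qed
  define b where "b j k = L2_set (haar_coeff (2 ^ N) t j k) {1..r}" for j k
  have b0: "0 \<le> b j k" for j k by (simp add: b_def L2_set_nonneg)
  define keep where "keep j k \<longleftrightarrow> 2 ^ j \<le> \<rho> \<or> 1 < b j k" for j k
  have tail: "(\<Sum>j<N. if 2 ^ j \<le> \<rho> then 0 else \<Sum>k<2 ^ j. b j k powr p) \<le> \<rho>"
  proof -
    have "\<rho> powr (p * \<gamma>) * (\<Sum>j<N. if 2 ^ j \<le> \<rho> then 0 else \<Sum>k<2 ^ j. b j k powr p)
        \<le> (\<Sum>j<N. 2 powr (real j * p * \<gamma>) * (\<Sum>k<2 ^ j. b j k powr p))"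
      unfolding sum_distrib_left[of _ _ "{..<N}"]
    proof (rule sum_mono)
      fix j
      show "\<rho> powr (p * \<gamma>) * (if 2 ^ j \<le> \<rho> then 0 else \<Sum>k<2 ^ j. b j k powr p)
        \<le> 2 powr (real j * p * \<gamma>) * (\<Sum>k<2 ^ j. b j k powr p)"
      proof (cases "2 ^ j \<le> \<rho>")
        case False
        have "\<rho> powr (p * \<gamma>) \<le> (2 ^ j) powr (p * \<gamma>)"
          using False \<rho>1 p \<gamma> by (intro powr_mono2) auto
        also have "\<dots> = 2 powr (real j * p * \<gamma>)"
          by (simp add: powr_realpow[symmetric] powr_powr mult.assoc)
        finally show ?thesis using False by (auto intro!: mult_right_mono sum_nonneg)
      qed (auto intro!: mult_nonneg_nonneg sum_nonneg)
    qed
    also have "\<dots> \<le> \<rho> powr (p * (\<alpha> + 1 / 2))"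
      using besov_levels_le[OF t p(1) N] unfolding \<rho>p b_def \<gamma>_def .
    \<comment> \<open>The exponents behind the choice of \<rho>: dividing \<rho>^(p (\<alpha> +
      1/2)) by the weight \<rho>^(p \<gamma>) leaves exactly \<rho>.\<close>
    also have "p * (\<alpha> + 1 / 2) = p * \<gamma> + 1" using p by (simp add: \<gamma>_def field_simps)
    also have "\<rho> powr (p * \<gamma> + 1) = \<rho> powr (p * \<gamma>) * \<rho>" using \<rho>1 by (simp add: powr_add)
    finally show ?thesis using \<rho>1 by simp
  qed
  obtain m where m: "partition_on (blk (2 ^ (N - 1)) 0) m" "m \<subseteq> dyadic_intervals N"
    "(\<Sum>I\<in>m. scatter r (even_cols t) I) \<le> tree_sum (\<lambda>j k. if keep j k then 0 else haar_energy r N t j k) N 0 0"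
    "card m \<le> 1 + (N - 1) * tree_sum (\<lambda>j k. of_bool (keep j k)) N 0 0"
    using adapted_partition_exists[of 0 "N - 1" N 0 r t keep] N by auto
  have part: "partition_on {1..2 ^ (N - 1)} m" using m(1) by (simp add: blk_def)
  have "tree_sum (\<lambda>j k. if keep j k then 0 else haar_energy r N t j k) N 0 0
      \<le> (\<Sum>j<N. if 2 ^ j \<le> \<rho> then 0 else \<Sum>k<2 ^ j. b j k powr p)"
    unfolding tree_sum_def
  proof (intro sum_mono)
    fix j
    show "(\<Sum>l<2 ^ j. if keep (0 + j) (0 * 2 ^ j + l) then 0 else haar_energy r N t (0 + j) (0 * 2 ^ j + l))
        \<le> (if 2 ^ j \<le> \<rho> then 0 else \<Sum>k<2 ^ j. b j k powr p)"
    proof (cases "2 ^ j \<le> \<rho>")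
      case False
      \<comment> \<open>Discarded coefficients have norm at most 1, where p \<le> 2 puts the square
        below the p-th power.\<close>
      have "(b j k)\<^sup>2 \<le> b j k powr p" if "b j k \<le> 1" for k
      proof (cases "b j k = 0")
        case nz: False
        have "b j k powr 2 \<le> b j k powr p"
          using nz b0[of j k] that p by (intro powr_mono') auto
        then show ?thesis using nz b0[of j k] by (simp add: powr_numeral)
      qed simp
      then show ?thesis using False
        unfolding keep_def haar_energy_def b_def[symmetric] by (auto intro!: sum_mono)
    qed (simp add: keep_def)
  qed
  then have bias: "(mnorm r (2 ^ (N - 1)) (even_cols t - block_mean r m (even_cols t)))\<^sup>2 \<le> \<rho>"
    using m(3) tail unfolding mnorm_diff_block_mean[OF part] by linarith
  have "real (tree_sum (\<lambda>j k. of_bool (keep j k)) N 0 0)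
      \<le> (\<Sum>j<N. (if 2 ^ j \<le> \<rho> then 2 ^ j else 0) + (if 2 ^ j \<le> \<rho> then 0 else \<Sum>k<2 ^ j. b j k powr p))"
    unfolding tree_sum_def of_nat_sum
  proof (intro sum_mono)
    fix j
    show "(\<Sum>l<2 ^ j. real (of_bool (keep (0 + j) (0 * 2 ^ j + l))))
      \<le> (if 2 ^ j \<le> \<rho> then 2 ^ j else 0) + (if 2 ^ j \<le> \<rho> then 0 else \<Sum>k<2 ^ j. b j k powr p)"
    proof (cases "2 ^ j \<le> \<rho>")
      case False
      \<comment> \<open>On a fine level a kept coefficient has norm above 1, so its p-th power
        counts it.\<close>
      have "of_bool (keep j k) \<le> b j k powr p" for k
        using False p ge_one_powr_ge_zero[of "b j k" p] by (auto simp: keep_def)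
      then have "(\<Sum>l<2 ^ j. of_bool (keep j l)) \<le> (\<Sum>k<2 ^ j. b j k powr p)" by (rule sum_mono)
      then show ?thesis using False by simp
    qed (simp add: keep_def)
  qed
  also have "\<dots> \<le> 3 * \<rho>"
    unfolding sum.distrib using tail sum_two_power_le[OF \<rho>1, of N] by linarith
  finally have K: "real (tree_sum (\<lambda>j k. of_bool (keep j k)) N 0 0) \<le> 3 * \<rho>" .
  have "real (card m) \<le> real (1 + (N - 1) * tree_sum (\<lambda>j k. of_bool (keep j k)) N 0 0)"
    using m(4) by (intro of_nat_mono)
  also have "\<dots> = 1 + real (N - 1) * real (tree_sum (\<lambda>j k. of_bool (keep j k)) N 0 0)" by simp
  also have "\<dots> \<le> 1 + real N * (3 * \<rho>)" using K by (intro add_left_mono mult_mono) auto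
  finally have "real (card m) \<le> 1 + 3 * real N * \<rho>" by (simp add: mult_ac)
  moreover have "m \<in> dyadic_partitions N" using part m(2) by (simp add: dyadic_partitions_def)
  ultimately show ?thesis using bias by blast
qed

section \<open>The lower bound for the minimax risk\<close>

lemma pmf_column:
  assumes s: "s \<in> prob_mats r n" and i: "i \<in> {1..n}"
  shows "pmf (embed_pmf (\<lambda>l. s l i)) l = s l i"
proof (rule pmf_embed_pmf)
  have zero: "s l i = 0" if "l \<notin> {1..r}" for l
    using s that by (auto simp: prob_mats_def Mat_def)
  show "0 \<le> s l i" for l
    using s i zero[of l] by (cases "l \<in> {1..r}") (auto simp: prob_mats_def)
  then have "(\<integral>\<^sup>+ l. ennreal (s l i) \<partial>count_space UNIV) = (\<Sum>l\<in>{1..r}. ennreal (s l i))"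
    by (intro nn_integral_count_space'[OF _ _ subset_UNIV]) (use zero in auto)
  also have "\<dots> = ennreal (\<Sum>l\<in>{1..r}. s l i)"
    using \<open>\<And>l. 0 \<le> s l i\<close> by (intro sum_ennreal) auto
  also have "\<dots> = 1" using s i by (simp add: prob_mats_def)
  finally show "(\<integral>\<^sup>+ l. ennreal (s l i) \<partial>count_space UNIV) = 1" .
qed

lemma set_pmf_column:
  assumes "s \<in> prob_mats r n" "i \<in> {1..n}"
  shows "set_pmf (embed_pmf (\<lambda>l. s l i)) \<subseteq> {1..r}"
  using assms(1) by (auto simp: set_pmf_eq pmf_column[OF assms] prob_mats_def Mat_def) force+

lemma set_pmf_law:
  assumes "s \<in> prob_mats r n"
  shows "set_pmf (law n s) \<subseteq> observations r n"
  unfolding law_def observations_def set_Pi_pmf[OF finite_atLeastAtMost]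
  using set_pmf_column[OF assms] unfolding PiE_dflt_def comp_def by blast

lemma pmf_law:
  assumes "s \<in> prob_mats r n" "y \<in> observations r n"
  shows "pmf (law n s) y = (\<Prod>i\<in>{1..n}. s (y i) i)"
  unfolding law_def using assms
  by (subst pmf_Pi') (auto simp: observations_def PiE_dflt_def pmf_column[OF assms(1)] intro!: prod.cong)

lemma finite_observations [simp]: "finite (observations r n)"
  by (auto simp: observations_def)

lemma risk_eq_sum:
  assumes "s \<in> prob_mats r n"
  shows "risk r n s e = ennreal (\<Sum>y\<in>observations r n. pmf (law n s) y * (mnorm r n (s - e y))\<^sup>2)"
proof -
  have "risk r n s e = (\<Sum>y\<in>observations r n. ennreal ((mnorm r n (s - e y))\<^sup>2) * ennreal (pmf (law n s) y))"
    unfolding risk_def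
    by (rule nn_integral_measure_pmf_support) (use set_pmf_law[OF assms] in auto)
  also have "\<dots> = (\<Sum>y\<in>observations r n. ennreal (pmf (law n s) y * (mnorm r n (s - e y))\<^sup>2))"
    by (simp add: ennreal_mult mult.commute)
  finally show ?thesis by (simp add: sum_ennreal)
qed

text \<open>The distributive law, up to padding: \<open>observations\<close> extends by 0,
  \<open>PiE\<close> by \<open>undefined\<close>.\<close>

lemma sum_observations_prod:
  fixes g :: "nat \<Rightarrow> nat \<Rightarrow> real"
  shows "(\<Sum>y\<in>observations r n. \<Prod>i\<in>{1..n}. g i (y i)) = (\<Prod>i\<in>{1..n}. \<Sum>l\<in>{1..r}. g i l)"
proof -
  let ?h = "\<lambda>f i. if i \<in> {1..n} then f i else (0 :: nat)"
  have "observations r n = ?h ` PiE {1..n} (\<lambda>_. {1..r})"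
    unfolding observations_def dflt_image_PiE[symmetric] ..
  moreover have "inj_on ?h (PiE {1..n} (\<lambda>_. {1..r}))"
  proof (rule inj_onI)
    fix f f' assume f: "f \<in> PiE {1..n} (\<lambda>_. {1..r})" "f' \<in> PiE {1..n} (\<lambda>_. {1..r})" and e: "?h f = ?h f'"
    show "f = f'"
    proof (rule PiE_ext[OF f])
      fix i assume "i \<in> {1..n}" then show "f i = f' i" using fun_cong[OF e, of i] by simp
    qed
  qed
  ultimately have "(\<Sum>y\<in>observations r n. \<Prod>i\<in>{1..n}. g i (y i))
      = (\<Sum>f\<in>PiE {1..n} (\<lambda>_. {1..r}). \<Prod>i\<in>{1..n}. g i (f i))"
    by (simp add: sum.reindex)
  then show ?thesis by (simp add: prod_sum_PiE)
qed

text \<open>As sqrt A + sqrt B \<ge> 1, Cauchy-Schwarz bounds the Hellinger affinity by sqrt R +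
  sqrt R', where R and R' are the two risks. Then 2 (R + R') \<ge> (3/4)^2, so the sum is at least
  9/32.\<close>

lemma two_point_hellinger:
  fixes P Q A B :: "'a \<Rightarrow> real"
  assumes nn: "\<And>y. y \<in> Y \<Longrightarrow> 0 \<le> P y \<and> 0 \<le> Q y \<and> 0 \<le> A y \<and> 0 \<le> B y"
    and one: "(\<Sum>y\<in>Y. P y) \<le> 1" "(\<Sum>y\<in>Y. Q y) \<le> 1"
    and sep: "\<And>y. y \<in> Y \<Longrightarrow> 1 \<le> sqrt (A y) + sqrt (B y)"
    and h: "3 / 4 \<le> (\<Sum>y\<in>Y. sqrt (P y * Q y))"
  shows "1 / 4 \<le> (\<Sum>y\<in>Y. P y * A y) + (\<Sum>y\<in>Y. Q y * B y)"
proof -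
  have cs: "(\<Sum>y\<in>Y. sqrt (f y) * sqrt (g y)) \<le> sqrt (\<Sum>y\<in>Y. f y)"
    if "\<And>y. y \<in> Y \<Longrightarrow> 0 \<le> f y \<and> 0 \<le> g y" "(\<Sum>y\<in>Y. g y) \<le> 1" for f g :: "'a \<Rightarrow> real"
  proof (rule real_le_rsqrt)
    have "(\<Sum>y\<in>Y. sqrt (f y) * sqrt (g y))\<^sup>2 \<le> (\<Sum>y\<in>Y. (sqrt (f y))\<^sup>2) * (\<Sum>y\<in>Y. (sqrt (g y))\<^sup>2)"
      by (rule Cauchy_Schwarz_ineq_sum)
    also have "\<dots> = (\<Sum>y\<in>Y. f y) * (\<Sum>y\<in>Y. g y)" using that(1) by simp
    also have "\<dots> \<le> (\<Sum>y\<in>Y. f y) * 1" using that by (intro mult_left_mono) (auto intro: sum_nonneg)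
    finally show "(\<Sum>y\<in>Y. sqrt (f y) * sqrt (g y))\<^sup>2 \<le> (\<Sum>y\<in>Y. f y)" by simp
  qed
  let ?R = "\<Sum>y\<in>Y. P y * A y" and ?R' = "\<Sum>y\<in>Y. Q y * B y"
  have R: "0 \<le> ?R" "0 \<le> ?R'" using nn by (auto intro!: sum_nonneg)
  have "3 / 4 \<le> (\<Sum>y\<in>Y. sqrt (P y * Q y) * 1)" using h by simp
  also have "\<dots> \<le> (\<Sum>y\<in>Y. sqrt (P y * Q y) * (sqrt (A y) + sqrt (B y)))"
    using sep nn by (intro sum_mono mult_left_mono) auto
  also have "\<dots> = (\<Sum>y\<in>Y. sqrt (P y * A y) * sqrt (Q y)) + (\<Sum>y\<in>Y. sqrt (Q y * B y) * sqrt (P y))"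
    unfolding sum.distrib[symmetric] by (intro sum.cong) (auto simp: real_sqrt_mult algebra_simps)
  also have "\<dots> \<le> sqrt ?R + sqrt ?R'"
    using nn one by (intro add_mono cs) auto
  finally have "(3 / 4)\<^sup>2 \<le> (sqrt ?R + sqrt ?R')\<^sup>2" by (intro power_mono) auto
  also have "\<dots> \<le> 2 * (?R + ?R')"
  proof -
    have "0 \<le> (sqrt ?R - sqrt ?R')\<^sup>2" by simp
    then show ?thesis using R by (simp add: power2_sum power2_diff)
  qed
  finally show ?thesis by (simp add: power2_eq_square)
qed

section \<open>Haar perturbations indexed by the vertices of a hypercube\<close>

definition step_sign :: "nat \<Rightarrow> nat set \<Rightarrow> nat \<Rightarrow> real" where
  "step_sign M S i = (if (i - 1) div (2 * M) \<in> S then 1 else - 1) * (if even ((i - 1) div M) then 1 else - 1)"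

lemma step_sign_cases: "step_sign M S i = 1 \<or> step_sign M S i = - 1"
  by (auto simp: step_sign_def)

lemma sum_step_sign_half:
  assumes "0 < M"
  shows "(\<Sum>i\<in>blk M (2 * k). step_sign M S i) = real M * (if k \<in> S then 1 else - 1)"
    and "(\<Sum>i\<in>blk M (2 * k + 1). step_sign M S i) = - (real M * (if k \<in> S then 1 else - 1))"
proof -
  have d: "step_sign M S i = (if (i - 1) div M div 2 \<in> S then 1 else - 1) * (if even ((i - 1) div M) then 1 else - 1)" for i
    unfolding step_sign_def by (simp add: div_mult2_eq mult.commute[of 2])
  have "step_sign M S i = (if k \<in> S then 1 else - 1)" if "i \<in> blk M (2 * k)" for i
  proof -
    have "(i - 1) div M = 2 * k" using that assms by (simp add: mem_blk_iff)
    then show ?thesis unfolding d by simp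
  qed
  then show "(\<Sum>i\<in>blk M (2 * k). step_sign M S i) = real M * (if k \<in> S then 1 else - 1)" by simp
  have "step_sign M S i = - (if k \<in> S then 1 else - 1)" if "i \<in> blk M (2 * k + 1)" for i
  proof -
    have "(i - 1) div M = 2 * k + 1" using that assms by (simp add: mem_blk_iff)
    then show ?thesis unfolding d by simp
  qed
  then show "(\<Sum>i\<in>blk M (2 * k + 1). step_sign M S i) = - (real M * (if k \<in> S then 1 else - 1))" by simp
qed

lemma sum_step_sign_coarse:
  assumes "0 < M"
  shows "(\<Sum>i\<in>blk (2 ^ Suc h * M) k. step_sign M S i) = 0"
proof (induction h arbitrary: k)
  case 0
  have "(\<Sum>i\<in>blk (2 * M) k. step_sign M S i) = 0"
    unfolding blk_split(1)[OF assms]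
    by (subst sum.union_disjoint)
       (use blk_split(2)[OF assms] sum_step_sign_half[OF assms] in simp_all)
  then show ?case by simp
next
  case (Suc h)
  have M: "0 < 2 ^ Suc h * M" using assms by simp
  have e: "2 ^ Suc (Suc h) * M = 2 * (2 ^ Suc h * M)" by simp
  show ?case
    unfolding e blk_split(1)[OF M]
    by (subst sum.union_disjoint) (use blk_split(2)[OF M] Suc.IH in simp_all)
qed

text \<open>Orthogonality of Haar levels, \<open>step_sign\<close> being up to scale a signed sum of
  the Haar functions of level J. On a coarser level each half consists of full oscillations and sums
  to zero; on a finer level the sign is constant over the block and the halves cancel.\<close>

lemma haar_diff_step_sign:
  assumes J: "J < N" and j: "j < N"
  defines "M \<equiv> 2 ^ (N - 1 - J)"
  shows "(\<Sum>i\<in>blk (2 ^ (N - 1 - j)) (2 * k). step_sign M S i)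
     - (\<Sum>i\<in>blk (2 ^ (N - 1 - j)) (2 * k + 1). step_sign M S i)
    = (if j = J then 2 * real M * (if k \<in> S then 1 else - 1) else 0)"
proof -
  have M: "0 < M" by (simp add: M_def)
  consider "j = J" | "j < J" | "J < j" by linarith
  then show ?thesis
  proof cases
    case 1
    then show ?thesis using sum_step_sign_half[OF M] by (simp add: M_def)
  next
    case 2
    define h where "h = J - Suc j"
    have "N - 1 - j = Suc h + (N - 1 - J)" using 2 J by (simp add: h_def)
    then have "2 ^ (N - 1 - j) = 2 ^ Suc h * M" unfolding M_def by (simp only: power_add)
    then show ?thesis using 2 sum_step_sign_coarse[OF M] by simp
  next
    case 3
    define L :: nat where "L = 2 ^ (N - 1 - j)"
    define h where "h = j - Suc J"
    have L: "0 < L" by (simp add: L_def)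
    have "N - 1 - J = Suc h + (N - 1 - j)" using 3 j by (simp add: h_def)
    then have M_eq: "M = (2 * L) * 2 ^ h" unfolding M_def L_def by (simp add: power_add)
    define c where "c = (if k div 2 ^ h div 2 \<in> S then 1 else - 1) * (if even (k div 2 ^ h) then 1 else - 1 :: real)"
    have "step_sign M S i = c" if "i \<in> blk (2 * L) k" for i
    proof -
      have "(i - 1) div (2 * L) = k" using that L by (simp add: mem_blk_iff)
      then have 1: "(i - 1) div M = k div 2 ^ h" unfolding M_eq by (simp add: div_mult2_eq)
      then have "(i - 1) div (2 * M) = k div 2 ^ h div 2"
        by (metis div_mult2_eq mult.commute)
      with 1 show ?thesis by (simp add: step_sign_def c_def)
    qed
    then have "(\<Sum>i\<in>blk L (2 * k). step_sign M S i) = real L * c"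
      "(\<Sum>i\<in>blk L (2 * k + 1). step_sign M S i) = real L * c"
      unfolding blk_split(1)[OF L] by simp_all
    then show ?thesis using 3 by (simp add: L_def)
  qed
qed

text \<open>Perturbing the law (1/2, 1/2) by opposite amounts in two rows keeps the column sums
  equal to 1, whatever r \<ge> 2 is.\<close>

definition hypercube_mat :: "nat \<Rightarrow> nat \<Rightarrow> real \<Rightarrow> nat set \<Rightarrow> rmat" where
  "hypercube_mat n M \<delta> S = (\<lambda>l i. if i \<in> {1..n} then
      (if l = 1 \<or> l = 2 then 1 / 2 else 0) +
      (if l = 1 then \<delta> else if l = 2 then - \<delta> else 0) * step_sign M S i else 0)"

lemma sum_first_two:
  fixes f :: "nat \<Rightarrow> real"
  assumes "2 \<le> r" "\<And>l. l \<noteq> 1 \<Longrightarrow> l \<noteq> 2 \<Longrightarrow> f l = 0"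
  shows "(\<Sum>l\<in>{1..r}. f l) = f 1 + f 2"
proof -
  have "(\<Sum>l\<in>{1..r}. f l) = (\<Sum>l\<in>{1, 2}. f l)"
    using assms by (intro sum.mono_neutral_right) auto
  then show ?thesis by simp
qed

lemma hypercube_mat_bounds:
  assumes "0 \<le> \<delta>" "\<delta> \<le> 1 / 4"
  shows "0 \<le> hypercube_mat n M \<delta> S l i"
  using assms step_sign_cases[of M S i] by (auto simp: hypercube_mat_def)

lemma hypercube_mat_prob:
  assumes "2 \<le> r" "0 \<le> \<delta>" "\<delta> \<le> 1 / 4"
  shows "hypercube_mat n M \<delta> S \<in> prob_mats r n"
proof -
  have "(\<Sum>l\<in>{1..r}. hypercube_mat n M \<delta> S l i) = 1" if "i \<in> {1..n}" for i
    by (subst sum_first_two[OF assms(1)]) (use that in \<open>auto simp: hypercube_mat_def\<close>)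
  moreover have "hypercube_mat n M \<delta> S \<in> Mat r n"
    using assms(1) by (auto simp: Mat_def hypercube_mat_def)
  ultimately show ?thesis
    using hypercube_mat_bounds[OF assms(2,3)] by (auto simp: prob_mats_def)
qed

text \<open>With \<delta>^2 = 1 / (16 M) the squared norm at level J is 2 (1 / (2M)) \<delta>^2 (4
  M^2) = 1/4. The same \<delta> gives neighbouring vertices affinity at least 3/4 and distance
  1.\<close>

lemma L2_set_haar_coeff_hypercube:
  assumes r: "2 \<le> r" and J: "J < N" and j: "j < N" and k: "k < 2 ^ j"
  defines "M \<equiv> 2 ^ (N - 1 - J)"
  assumes \<delta>: "\<delta>\<^sup>2 = 1 / (16 * real M)"
  shows "L2_set (haar_coeff (2 ^ N) (hypercube_mat (2 ^ N) M \<delta> S) j k) {1..r} = (if j = J then 1 / 2 else 0)"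
proof -
  let ?t = "hypercube_mat (2 ^ N) M \<delta> S"
  define d where "d l = (if l = 1 then \<delta> else if l = 2 then - \<delta> else 0)" for l :: nat
  define c where "c l = (if l = 1 \<or> l = 2 then 1 / 2 else 0 :: real)" for l :: nat
  define e :: real where "e = (if k \<in> S then 1 else - 1)"
  have t: "?t l i = c l + d l * step_sign M S i" if "i \<in> {1..2 ^ N}" for l i
    using that by (simp add: hypercube_mat_def c_def d_def)
  define L :: nat where "L = 2 ^ (N - 1 - j)"
  have sub: "blk L (2 * k) \<subseteq> {1..2 ^ N}" "blk L (2 * k + 1) \<subseteq> {1..2 ^ N}"
    using blk_subset_grid[of "Suc j" N "2 * k"] blk_subset_grid[of "Suc j" N "2 * k + 1"] j k
    by (simp_all add: L_def)
  have sums: "(\<Sum>i\<in>B. ?t l i) = real (card B) * c l + d l * (\<Sum>i\<in>B. step_sign M S i)"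
    if "B \<subseteq> {1..2 ^ N}" for B l
  proof -
    have "(\<Sum>i\<in>B. ?t l i) = (\<Sum>i\<in>B. c l + d l * step_sign M S i)"
      using that t by (intro sum.cong) auto
    then show ?thesis by (simp add: sum.distrib sum_distrib_left)
  qed
  have "haar_coeff (2 ^ N) ?t j k l = 2 powr (real j / 2) / sqrt (2 ^ N) *
      (d l * ((\<Sum>i\<in>blk L (2 * k). step_sign M S i) - (\<Sum>i\<in>blk L (2 * k + 1). step_sign M S i)))" for l
    unfolding haar_coeff_eq[OF j k] L_def[symmetric] sums[OF sub(1)] sums[OF sub(2)] card_blk
    by (simp add: algebra_simps)
  then have hc: "haar_coeff (2 ^ N) ?t j k l = 2 powr (real j / 2) / sqrt (2 ^ N) *
      (d l * (if j = J then 2 * real M * e else 0))" for l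
    using haar_diff_step_sign[OF J j, where k = k and S = S] unfolding L_def M_def e_def by simp
  show ?thesis
  proof (cases "j = J")
    case False
    then show ?thesis unfolding hc L2_set_def by simp
  next
    case True
    have "(2 ^ J * (2 * 2 ^ (N - 1 - J)) :: real) = 2 ^ N"
      using J by (simp flip: power_add power_Suc)
    then have N: "2 ^ N = 2 ^ J * (2 * real M)" by (simp add: M_def)
    have M: "0 < real M" by (simp add: M_def)
    have p: "(2 powr (real J / 2))\<^sup>2 = (2 :: real) ^ J" by (simp add: powr_power powr_realpow)
    have e: "e\<^sup>2 = 1" by (simp add: e_def)
    have "(\<Sum>l\<in>{1..r}. (haar_coeff (2 ^ N) ?t j k l)\<^sup>2) = (haar_coeff (2 ^ N) ?t j k 1)\<^sup>2 + (haar_coeff (2 ^ N) ?t j k 2)\<^sup>2"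
      by (rule sum_first_two[OF r]) (simp add: hc d_def)
    also have "\<dots> = 2 * (((2 powr (real J / 2))\<^sup>2 / (sqrt (2 ^ N))\<^sup>2) * (\<delta>\<^sup>2 * (4 * (real M)\<^sup>2 * e\<^sup>2)))"
      unfolding hc using True by (simp add: d_def power_mult_distrib power_divide)
    also have "\<dots> = (1 / 2)\<^sup>2"
      unfolding p e \<delta> using M N by (simp add: power2_eq_square field_simps)
    finally show ?thesis unfolding L2_set_def using True by (simp only: real_sqrt_abs) simp
  qed
qed

text \<open>Only level J contributes, with 2^J coefficients of norm 1/2, so the Besov norm is 2^(J
  (\<alpha> + 1/2)) / 2 for every p.\<close>

lemma hypercube_mat_besov:
  assumes r: "2 \<le> r" and J: "J < N" and p: "0 < p"
  defines "M \<equiv> 2 ^ (N - 1 - J)"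
  assumes \<delta>: "\<delta>\<^sup>2 = 1 / (16 * real M)" "0 \<le> \<delta>" "\<delta> \<le> 1 / 4"
    and R: "2 powr (real J * (\<alpha> + 1 / 2)) \<le> 2 * (sqrt (2 ^ N) * R)"
  shows "hypercube_mat (2 ^ N) M \<delta> S \<in> prob_besov r N \<alpha> p R"
proof -
  let ?t = "hypercube_mat (2 ^ N) M \<delta> S"
  let ?\<gamma> = "\<alpha> + 1 / 2 - 1 / p"
  have sets: "{0..N - 1} = {..<N}" "\<And>j. {0..2 ^ j - 1} = {..<2 ^ j :: nat}"
    by (rule atLeast0AtMost_minus_one, use J in simp)+
  have "(\<Sum>j<N. 2 powr (real j * p * ?\<gamma>) * (\<Sum>k<2 ^ j. (L2_set (haar_coeff (2 ^ N) ?t j k) {1..r}) powr p))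
      = (\<Sum>j<N. if j = J then 2 powr (real J * p * ?\<gamma>) * (2 ^ J * (1 / 2) powr p) else 0)"
    using L2_set_haar_coeff_hypercube[OF r J, of _ _ \<delta> S] \<delta>(1) unfolding M_def
    by (intro sum.cong refl) simp
  also have "\<dots> = 2 powr (real J * p * ?\<gamma>) * (2 powr real J * (1 / 2) powr p)"
    using J by (simp add: powr_realpow)
  also have "\<dots> = 2 powr (real J * p * ?\<gamma> + real J) * (1 / 2) powr p"
    by (simp add: powr_add)
  also have "real J * p * ?\<gamma> + real J = real J * (\<alpha> + 1 / 2) * p"
    using p by (simp add: field_simps)
  also have "2 powr (real J * (\<alpha> + 1 / 2) * p) * (1 / 2) powr p = (2 powr (real J * (\<alpha> + 1 / 2)) * (1 / 2)) powr p"
    by (simp add: powr_powr[symmetric] powr_mult[symmetric])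
  finally have S: "(\<Sum>j<N. 2 powr (real j * p * ?\<gamma>) * (\<Sum>k<2 ^ j. (L2_set (haar_coeff (2 ^ N) ?t j k) {1..r}) powr p))
      = (2 powr (real J * (\<alpha> + 1 / 2)) * (1 / 2)) powr p" .
  have "((2 powr (real J * (\<alpha> + 1 / 2)) * (1 / 2)) powr p) powr (1 / p) \<le> sqrt (real (2 ^ N)) * R"
    using R p by (simp add: powr_powr)
  moreover have "?t \<in> Mat r (2 ^ N)"
    using hypercube_mat_prob[OF r \<delta>(2,3)] by (simp add: prob_mats_def)
  ultimately have "?t \<in> besov_body r N \<alpha> p R"
    unfolding besov_body_def Let_def sets S[symmetric] by blast
  then show ?thesis
    using hypercube_mat_prob[OF r \<delta>(2,3)] by (simp add: prob_besov_def)
qed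

definition toggle :: "nat \<Rightarrow> nat set \<Rightarrow> nat set" where
  "toggle k S = (if k \<in> S then S - {k} else insert k S)"

lemma toggle_toggle [simp]: "toggle k (toggle k S) = S"
  by (auto simp: toggle_def)

lemma mem_toggle: "a \<in> toggle k S \<longleftrightarrow> (if a = k then a \<notin> S else a \<in> S)"
  by (simp add: toggle_def)

lemma toggle_subset: "k < K \<Longrightarrow> S \<subseteq> {..<K} \<Longrightarrow> toggle k S \<subseteq> {..<K}"
  by (auto simp: toggle_def)

lemma step_sign_toggle:
  "step_sign M (toggle k S) i = (if (i - 1) div (2 * M) = k then - step_sign M S i else step_sign M S i)"
  unfolding step_sign_def mem_toggle by (simp split: if_split)

lemma real_sqrt_prod: "sqrt (\<Prod>i\<in>A. f i) = (\<Prod>i\<in>A. sqrt (f i))"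
  by (induction A rule: infinite_finite_induct) (simp_all add: real_sqrt_mult)

text \<open>Affinities of product laws multiply, and only the 2M columns of block k differ, each
  with affinity sqrt (1 - 4 \<delta>^2). Bernoulli's inequality gives (1 - 4 \<delta>^2)^M \<ge> 1 -
  4 M \<delta>^2 = 3/4.\<close>

lemma hellinger_affinity_hypercube:
  assumes r: "2 \<le> r" and J: "J < N" and k: "k < 2 ^ J"
  defines "M \<equiv> 2 ^ (N - 1 - J)"
  assumes \<delta>: "\<delta>\<^sup>2 = 1 / (16 * real M)" "0 \<le> \<delta>" "\<delta> \<le> 1 / 4"
  shows "3 / 4 \<le> (\<Sum>y\<in>observations r (2 ^ N).
    sqrt (pmf (law (2 ^ N) (hypercube_mat (2 ^ N) M \<delta> S)) y
        * pmf (law (2 ^ N) (hypercube_mat (2 ^ N) M \<delta> (toggle k S))) y))"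
proof -
  let ?s = "hypercube_mat (2 ^ N) M \<delta> S" and ?s' = "hypercube_mat (2 ^ N) M \<delta> (toggle k S)"
  have M: "0 < M" by (simp add: M_def)
  have M2: "2 * M = 2 ^ (N - J)" using J by (simp add: M_def Suc_diff_Suc flip: power_Suc)
  have sub: "blk (2 * M) k \<subseteq> {1..2 ^ N}" using blk_subset_grid[of J N k] J k by (simp add: M2)
  have col: "(\<Sum>l\<in>{1..r}. sqrt (?s l i * ?s' l i)) = (if i \<in> blk (2 * M) k then sqrt (1 - 4 * \<delta>\<^sup>2) else 1)"
    if i: "i \<in> {1..2 ^ N}" for i
  proof -
    have "(\<Sum>l\<in>{1..r}. sqrt (?s l i * ?s' l i)) = sqrt (?s 1 i * ?s' 1 i) + sqrt (?s 2 i * ?s' 2 i)"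
      by (rule sum_first_two[OF r]) (simp add: hypercube_mat_def)
    also have "\<dots> = (if i \<in> blk (2 * M) k then sqrt (1 - 4 * \<delta>\<^sup>2) else 1)"
    proof (cases "i \<in> blk (2 * M) k")
      case True
      then have "step_sign M (toggle k S) i = - step_sign M S i"
        using M by (simp add: mem_blk_iff step_sign_toggle)
      then have "?s 1 i * ?s' 1 i = 1 / 4 - \<delta>\<^sup>2" "?s 2 i * ?s' 2 i = 1 / 4 - \<delta>\<^sup>2"
        using i step_sign_cases[of M S i] by (auto simp: hypercube_mat_def algebra_simps power2_eq_square)
      moreover have "sqrt (1 - 4 * \<delta>\<^sup>2) = sqrt (4 * (1 / 4 - \<delta>\<^sup>2))" by (simp add: algebra_simps)
      moreover have "\<dots> = 2 * sqrt (1 / 4 - \<delta>\<^sup>2)" unfolding real_sqrt_mult by simp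
      ultimately show ?thesis using True by simp
    next
      case False
      then have "step_sign M (toggle k S) i = step_sign M S i"
        using M i by (simp add: mem_blk_iff step_sign_toggle)
      then have "?s' l i = ?s l i" for l by (simp add: hypercube_mat_def)
      moreover have "?s 1 i + ?s 2 i = 1" using i by (simp add: hypercube_mat_def)
      ultimately show ?thesis using False hypercube_mat_bounds[OF \<delta>(2,3)] by simp
    qed
    finally show ?thesis .
  qed
  have P: "?s \<in> prob_mats r (2 ^ N)" "?s' \<in> prob_mats r (2 ^ N)"
    by (rule hypercube_mat_prob[OF r \<delta>(2,3)])+
  have "(\<Sum>y\<in>observations r (2 ^ N). sqrt (pmf (law (2 ^ N) ?s) y * pmf (law (2 ^ N) ?s') y))
      = (\<Sum>y\<in>observations r (2 ^ N). \<Prod>i\<in>{1..2 ^ N}. sqrt (?s (y i) i * ?s' (y i) i))"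
    by (intro sum.cong refl) (simp add: pmf_law[OF P(1)] pmf_law[OF P(2)] prod.distrib[symmetric] real_sqrt_prod)
  also have "\<dots> = (\<Prod>i\<in>{1..2 ^ N}. \<Sum>l\<in>{1..r}. sqrt (?s l i * ?s' l i))"
    by (rule sum_observations_prod)
  also have "\<dots> = (\<Prod>i\<in>{1..2 ^ N}. if i \<in> blk (2 * M) k then sqrt (1 - 4 * \<delta>\<^sup>2) else 1)"
    by (rule prod.cong[OF refl col])
  also have "\<dots> = (\<Prod>i\<in>blk (2 * M) k. sqrt (1 - 4 * \<delta>\<^sup>2))"
    using sub by (subst prod.inter_restrict[symmetric]) (simp_all add: Int_absorb1)
  also have "\<dots> = ((sqrt (1 - 4 * \<delta>\<^sup>2))\<^sup>2) ^ M" by (simp add: power_mult)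
  also have "\<dots> = (1 + - 4 * \<delta>\<^sup>2) ^ M"
  proof -
    have "\<delta>\<^sup>2 \<le> (1 / 4)\<^sup>2" using \<delta>(2,3) by (intro power_mono)
    then show ?thesis by (simp add: power2_eq_square)
  qed
  finally have eq: "(\<Sum>y\<in>observations r (2 ^ N). sqrt (pmf (law (2 ^ N) ?s) y * pmf (law (2 ^ N) ?s') y))
      = (1 + - 4 * \<delta>\<^sup>2) ^ M" .
  have "real M * (4 * \<delta>\<^sup>2) = 1 / 4" unfolding \<delta>(1) using M by simp
  then have "3 / 4 = 1 + real M * (- 4 * \<delta>\<^sup>2)" by simp
  also have "\<dots> \<le> (1 + - 4 * \<delta>\<^sup>2) ^ M"
  proof (rule Bernoulli_inequality)
    have "\<delta>\<^sup>2 \<le> (1 / 4)\<^sup>2" using \<delta>(2,3) by (intro power_mono)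
    then show "- 1 \<le> - 4 * \<delta>\<^sup>2" by (simp add: power2_eq_square)
  qed
  finally show ?thesis unfolding eq .
qed

section \<open>Assouad's argument over the blocks\<close>

definition block_loss :: "nat \<Rightarrow> nat set \<Rightarrow> rmat \<Rightarrow> rmat \<Rightarrow> real" where
  "block_loss r B s t = (\<Sum>l\<in>{1..r}. \<Sum>i\<in>B. (s l i - t l i)\<^sup>2)"

lemma block_loss_nonneg: "0 \<le> block_loss r B s t"
  by (simp add: block_loss_def sum_nonneg)

lemma sqrt_block_loss: "sqrt (block_loss r B s t) = L2_set (\<lambda>(l, i). s l i - t l i) ({1..r} \<times> B)"
  by (simp add: block_loss_def L2_set_def sum.cartesian_product case_prod_unfold)

text \<open>On the block, 2M columns change in two rows by 2\<delta> each, so the two vertices are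
  at distance exactly 1; the triangle inequality through t concludes.\<close>

lemma block_loss_hypercube_separation:
  assumes r: "2 \<le> r" and J: "J < N" and k: "k < 2 ^ J"
  defines "M \<equiv> 2 ^ (N - 1 - J)"
  assumes \<delta>: "\<delta>\<^sup>2 = 1 / (16 * real M)"
  shows "1 \<le> sqrt (block_loss r (blk (2 * M) k) (hypercube_mat (2 ^ N) M \<delta> S) t)
    + sqrt (block_loss r (blk (2 * M) k) (hypercube_mat (2 ^ N) M \<delta> (toggle k S)) t)"
proof -
  let ?s = "hypercube_mat (2 ^ N) M \<delta> S" and ?s' = "hypercube_mat (2 ^ N) M \<delta> (toggle k S)"
  let ?B = "blk (2 * M) k"
  have M: "0 < M" by (simp add: M_def)
  have M2: "2 * M = 2 ^ (N - J)" using J by (simp add: M_def Suc_diff_Suc flip: power_Suc)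
  have sub: "?B \<subseteq> {1..2 ^ N}" using blk_subset_grid[of J N k] J k by (simp add: M2)
  have sq: "(?s l i - ?s' l i)\<^sup>2 = (if l = 1 \<or> l = 2 then 4 * \<delta>\<^sup>2 else 0)" if i: "i \<in> ?B" for l i
  proof -
    have "step_sign M (toggle k S) i = - step_sign M S i"
      using M i by (simp add: mem_blk_iff step_sign_toggle)
    then show ?thesis
      using sub i step_sign_cases[of M S i] by (auto simp: hypercube_mat_def power2_eq_square)
  qed
  have "block_loss r ?B ?s ?s' = (\<Sum>l\<in>{1..r}. \<Sum>i\<in>?B. if l = 1 \<or> l = 2 then 4 * \<delta>\<^sup>2 else 0)"
    unfolding block_loss_def by (intro sum.cong refl sq)
  also have "\<dots> = 2 * (real (2 * M) * (4 * \<delta>\<^sup>2))"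
    by (subst sum_first_two[OF r]) auto
  also have "\<dots> = 1" unfolding \<delta> using M by simp
  finally have "1 = sqrt (block_loss r ?B ?s ?s')" by simp
  also have "\<dots> = L2_set (\<lambda>li. (case li of (l, i) \<Rightarrow> ?s l i - t l i) + (case li of (l, i) \<Rightarrow> t l i - ?s' l i)) ({1..r} \<times> ?B)"
    unfolding sqrt_block_loss by (intro L2_set_cong) auto
  also have "\<dots> \<le> L2_set (\<lambda>(l, i). ?s l i - t l i) ({1..r} \<times> ?B) + L2_set (\<lambda>(l, i). t l i - ?s' l i) ({1..r} \<times> ?B)"
    by (rule L2_set_triangle_ineq)
  also have "L2_set (\<lambda>(l, i). t l i - ?s' l i) ({1..r} \<times> ?B) = L2_set (\<lambda>(l, i). ?s' l i - t l i) ({1..r} \<times> ?B)"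
    unfolding L2_set_def by (intro arg_cong[where f = sqrt] sum.cong refl) (auto simp: power2_commute)
  finally show ?thesis unfolding sqrt_block_loss .
qed

lemma partition_on_blks:
  assumes "0 < L"
  shows "partition_on {1..K * L} (blk L ` {..<K})" "inj_on (blk L) {..<K}"
proof -
  have ex: "i \<in> blk L k \<longleftrightarrow> 1 \<le> i \<and> (i - 1) div L = k" for i k using assms by (rule mem_blk_iff)
  show "partition_on {1..K * L} (blk L ` {..<K})"
  proof (rule partition_onI)
    show "\<Union> (blk L ` {..<K}) = {1..K * L}"
    proof (intro set_eqI iffI)
      fix i assume "i \<in> {1..K * L}"
      then have "i - 1 < K * L" by auto
      then have "(i - 1) div L < K" using assms by (simp add: less_mult_imp_div_less)
      then show "i \<in> \<Union> (blk L ` {..<K})" using \<open>i \<in> {1..K * L}\<close> by (auto simp: ex)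
    next
      fix i assume "i \<in> \<Union> (blk L ` {..<K})"
      then obtain k where k: "k < K" "i \<in> blk L k" by auto
      then have "i \<le> (k + 1) * L" "1 \<le> i" by (auto simp: blk_def)
      moreover have "(k + 1) * L \<le> K * L" using k(1) by (intro mult_right_mono) auto
      ultimately show "i \<in> {1..K * L}" by simp
    qed
    show "{} \<notin> blk L ` {..<K}"
    proof
      assume "{} \<in> blk L ` {..<K}"
      then show False using blk_nonempty[OF assms] by (metis imageE)
    qed
    show "disjnt p q" if "p \<in> blk L ` {..<K}" "q \<in> blk L ` {..<K}" "p \<noteq> q" for p q
      using that ex by (auto simp: disjnt_def)
  qed
  show "inj_on (blk L) {..<K}"
  proof (rule inj_onI)
    fix a b assume "blk L a = blk L b"
    then have "(a + 1) * L \<in> blk L b" using assms by (auto simp: blk_def)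
    moreover have "(a + 1) * L \<in> blk L a" using assms by (auto simp: blk_def)
    ultimately show "a = b" by (simp add: ex)
  qed
qed

lemma mnorm_sq_eq_sum_block_loss:
  assumes "0 < L"
  shows "(mnorm r (K * L) (s - t))\<^sup>2 = (\<Sum>k<K. block_loss r (blk L k) s t)"
proof -
  have "(mnorm r (K * L) (s - t))\<^sup>2 = (\<Sum>l\<in>{1..r}. \<Sum>k<K. \<Sum>i\<in>blk L k. (s l i - t l i)\<^sup>2)"
    unfolding mnorm_sq sum_partition_on[OF partition_on_blks(1)[OF assms] finite_atLeastAtMost]
      sum.reindex[OF partition_on_blks(2)[OF assms]] by simp
  then show ?thesis unfolding block_loss_def by (subst sum.swap) simp
qed

text \<open>The loss is a sum over 2^J blocks. Toggling k permutes the vertices, so pairing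
  neighbours shows that the local risk on block k averages to at least 1/8 over all S; hence some
  vertex has total risk at least 2^J / 8.\<close>

lemma assouad_hypercube:
  fixes e :: "(nat \<Rightarrow> nat) \<Rightarrow> rmat"
  assumes r: "2 \<le> r" and J: "J < N"
  defines "M \<equiv> 2 ^ (N - 1 - J)"
  assumes \<delta>: "\<delta>\<^sup>2 = 1 / (16 * real M)" "0 \<le> \<delta>" "\<delta> \<le> 1 / 4"
  shows "\<exists>S. ennreal (2 ^ J / 8) \<le> risk r (2 ^ N) (hypercube_mat (2 ^ N) M \<delta> S) e"
proof -
  let ?n = "2 ^ N :: nat" and ?K = "2 ^ J :: nat" and ?Y = "observations r (2 ^ N)"
  let ?s = "hypercube_mat ?n M \<delta>"
  have M: "0 < M" by (simp add: M_def)
  have n: "?n = ?K * (2 * M)" using J by (simp add: M_def flip: power_add power_Suc)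
  have P: "?s S \<in> prob_mats r ?n" for S by (rule hypercube_mat_prob[OF r \<delta>(2,3)])
  define R where "R k S = (\<Sum>y\<in>?Y. pmf (law ?n (?s S)) y * block_loss r (blk (2 * M) k) (?s S) (e y))" for k S
  define rr where "rr S = (\<Sum>y\<in>?Y. pmf (law ?n (?s S)) y * (mnorm r ?n (?s S - e y))\<^sup>2)" for S
  have rr: "rr S = (\<Sum>k<?K. R k S)" for S
  proof -
    have "rr S = (\<Sum>y\<in>?Y. \<Sum>k<?K. pmf (law ?n (?s S)) y * block_loss r (blk (2 * M) k) (?s S) (e y))"
      unfolding rr_def using mnorm_sq_eq_sum_block_loss[of "2 * M" r ?K "?s S"] M
      by (simp add: n[symmetric] sum_distrib_left)
    then show ?thesis unfolding R_def by (subst (asm) sum.swap) simp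
  qed
  have pair: "1 / 4 \<le> R k S + R k (toggle k S)" if k: "k < ?K" for k S
    unfolding R_def
  proof (rule two_point_hellinger)
    show "(\<Sum>y\<in>?Y. pmf (law ?n (?s S)) y) \<le> 1" "(\<Sum>y\<in>?Y. pmf (law ?n (?s (toggle k S))) y) \<le> 1"
      using sum_pmf_eq_1[OF finite_observations set_pmf_law[OF P]] by simp_all
    show "3 / 4 \<le> (\<Sum>y\<in>?Y. sqrt (pmf (law ?n (?s S)) y * pmf (law ?n (?s (toggle k S))) y))"
      using hellinger_affinity_hypercube[OF r J k] \<delta> unfolding M_def by blast
    show "1 \<le> sqrt (block_loss r (blk (2 * M) k) (?s S) (e y)) + sqrt (block_loss r (blk (2 * M) k) (?s (toggle k S)) (e y))" for y
      using block_loss_hypercube_separation[OF r J k] \<delta>(1) unfolding M_def by blast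
  qed (simp_all add: block_loss_nonneg)
  have avg: "2 ^ ?K / 8 \<le> (\<Sum>S\<in>Pow {..<?K}. R k S)" if k: "k < ?K" for k
  proof -
    have "(\<Sum>S\<in>Pow {..<?K}. R k S) = (\<Sum>S\<in>Pow {..<?K}. R k (toggle k S))"
      by (rule sum.reindex_bij_witness[of _ "toggle k" "toggle k"])
         (use k toggle_subset in \<open>simp_all only: toggle_toggle Pow_iff lessThan_iff\<close>)
    then have "2 * (\<Sum>S\<in>Pow {..<?K}. R k S) = (\<Sum>S\<in>Pow {..<?K}. R k S + R k (toggle k S))"
      by (simp add: sum.distrib)
    moreover have "(\<Sum>S\<in>Pow {..<?K}. 1 / 4) \<le> (\<Sum>S\<in>Pow {..<?K}. R k S + R k (toggle k S))"
      by (intro sum_mono pair k)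
    moreover have "(\<Sum>S\<in>Pow {..<?K}. 1 / 4 :: real) = 2 ^ ?K / 4" by (simp add: card_Pow)
    ultimately show ?thesis by linarith
  qed
  have "\<exists>S. 2 ^ J / 8 \<le> rr S"
  proof (rule ccontr)
    assume "\<nexists>S. 2 ^ J / 8 \<le> rr S"
    then have "(\<Sum>S\<in>Pow {..<?K}. rr S) < (\<Sum>S\<in>Pow {..<?K}. 2 ^ J / 8)"
      by (intro sum_strict_mono) (auto simp: not_le)
    also have "\<dots> = (\<Sum>k<?K. 2 ^ ?K / 8)" by (simp add: card_Pow)
    also have "\<dots> \<le> (\<Sum>k<?K. \<Sum>S\<in>Pow {..<?K}. R k S)" by (intro sum_mono avg) simp
    also have "\<dots> = (\<Sum>S\<in>Pow {..<?K}. rr S)" unfolding rr by (rule sum.swap)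
    finally show False by simp
  qed
  then show ?thesis unfolding risk_eq_sum[OF P] rr_def[symmetric] using ennreal_leI by blast
qed

lemma ex_power_two_bracket:
  fixes x :: real
  assumes "1 \<le> x"
  shows "\<exists>J. 2 ^ J \<le> x \<and> x < 2 ^ Suc J"
proof -
  obtain m where m: "x < 2 ^ m" using real_arch_pow[of 2 x] by auto
  define L where "L = (LEAST m. x < 2 ^ m)"
  have L: "x < 2 ^ L" unfolding L_def using m by (rule LeastI)
  then obtain J where J: "L = Suc J" using assms by (cases L) auto
  then have "\<not> x < 2 ^ J" unfolding L_def using not_less_Least by (metis lessI)
  then show ?thesis using L J by (intro exI[of _ J]) auto
qed

lemma minimax_risk_lower_bound:
  fixes \<alpha> p R :: real and N :: nat
  defines "\<rho> \<equiv> (sqrt (2 ^ N) * R) powr (2 / (2 * \<alpha> + 1))"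
  assumes r: "2 \<le> r" and p: "0 < p" and \<alpha>: "0 < \<alpha>"
    and R: "1 \<le> sqrt (2 ^ N) * R" "R < (2 ^ N) powr \<alpha>"
  shows "ennreal (\<rho> / 16) \<le> minimax_risk r N \<alpha> p R"
proof -
  let ?X = "sqrt (2 ^ N) * R"
  have \<rho>1: "1 \<le> \<rho>" unfolding \<rho>_def using R \<alpha> by (intro ge_one_powr_ge_zero) auto
  have \<rho>X: "\<rho> powr (\<alpha> + 1 / 2) = ?X"
  proof -
    have "2 / (2 * \<alpha> + 1) * (\<alpha> + 1 / 2) = 1" using \<alpha> by (simp add: field_simps)
    then show ?thesis unfolding \<rho>_def powr_powr using R by simp
  qed
  have "?X < (2 ^ N) powr (1 / 2) * (2 ^ N) powr \<alpha>"
    using R(2) by (simp add: powr_half_sqrt)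
  also have "\<dots> = (2 ^ N) powr (\<alpha> + 1 / 2)" by (simp add: powr_add)
  finally have lt: "\<rho> powr (\<alpha> + 1 / 2) < (2 ^ N) powr (\<alpha> + 1 / 2)" unfolding \<rho>X .
  \<comment> \<open>The assumption R < n^\<alpha> says precisely that \<rho> < n, so the level J
    exists in the Haar basis.\<close>
  have "\<rho> < 2 ^ N"
  proof (rule ccontr)
    assume "\<not> \<rho> < 2 ^ N"
    then have "(2 ^ N) powr (\<alpha> + 1 / 2) \<le> \<rho> powr (\<alpha> + 1 / 2)" using \<alpha> by (intro powr_mono2) auto
    then show False using lt by simp
  qed
  obtain J where J: "2 ^ J \<le> \<rho>" "\<rho> < 2 ^ Suc J" using ex_power_two_bracket[OF \<rho>1] by auto
  have "(2 :: real) ^ J < 2 ^ N" using J(1) \<open>\<rho> < 2 ^ N\<close> by linarith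
  then have JN: "J < N" by simp
  define M :: nat where "M = 2 ^ (N - 1 - J)"
  have M: "1 \<le> real M" by (simp add: M_def)
  define \<delta> where "\<delta> = sqrt (1 / (16 * real M))"
  have \<delta>: "\<delta>\<^sup>2 = 1 / (16 * real M)" "0 \<le> \<delta>" by (simp_all add: \<delta>_def)
  have "\<delta> \<le> sqrt ((1 / 4)\<^sup>2)"
    unfolding \<delta>_def using M by (intro real_sqrt_le_mono) (simp add: power2_eq_square field_simps)
  then have \<delta>4: "\<delta> \<le> 1 / 4" by simp
  have "2 powr (real J * (\<alpha> + 1 / 2)) = (2 ^ J) powr (\<alpha> + 1 / 2)"
    by (simp add: powr_powr[symmetric] powr_realpow)
  also have "\<dots> \<le> \<rho> powr (\<alpha> + 1 / 2)" using J(1) \<alpha> by (intro powr_mono2) auto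
  finally have XJ: "2 powr (real J * (\<alpha> + 1 / 2)) \<le> 2 * ?X" unfolding \<rho>X using R by linarith
  show ?thesis unfolding minimax_risk_def
  proof (rule INF_greatest)
    fix e :: "(nat \<Rightarrow> nat) \<Rightarrow> rmat"
    obtain S where S: "ennreal (2 ^ J / 8) \<le> risk r (2 ^ N) (hypercube_mat (2 ^ N) M \<delta> S) e"
      using assouad_hypercube[OF r JN] \<delta> \<delta>4 unfolding M_def by blast
    \<comment> \<open>Rounding \<rho> down to a power of 2 loses a factor of at most 2.\<close>
    have "ennreal (\<rho> / 16) \<le> ennreal (2 ^ J / 8)" using J(2) by (intro ennreal_leI) simp
    also note S
    also have "risk r (2 ^ N) (hypercube_mat (2 ^ N) M \<delta> S) e \<le> (SUP s \<in> prob_besov r N \<alpha> p R. risk r (2 ^ N) s e)"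
      using hypercube_mat_besov[OF r JN p, of \<delta> \<alpha> R S] \<delta> \<delta>4 XJ unfolding M_def by (intro SUP_upper) blast
    finally show "ennreal (\<rho> / 16) \<le> (SUP s \<in> prob_besov r N \<alpha> p R. risk r (2 ^ N) s e)" .
  qed
qed

section \<open>The risk of the hybrid estimator\<close>

lemma block_energy_cong:
  assumes "\<And>l i. l \<in> {1..r} \<Longrightarrow> i \<in> I \<Longrightarrow> z l i = z' l i"
  shows "block_energy r z I = block_energy r z' I"
  unfolding block_energy_def using assms by (intro arg_cong2[where f = "(/)"] sum.cong refl arg_cong[where f = "\<lambda>x. x\<^sup>2"])

lemma noise_excess_cong:
  assumes "\<And>l i. l \<in> {1..r} \<Longrightarrow> i \<in> {1..2 ^ h} \<Longrightarrow> z l i = z' l i"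
  shows "noise_excess r h z = noise_excess r h z'"
  unfolding noise_excess_def
proof (intro sum.cong refl)
  fix m assume "m \<in> dyadic_block_partitions h 0"
  then have p: "partition_on {1..2 ^ h} m" by (simp add: dyadic_block_partitions_def blk_def)
  have "block_energy r z I = block_energy r z' I" if "I \<in> m" for I
  proof (rule block_energy_cong)
    fix l i assume li: "l \<in> {1..r}" "i \<in> I"
    have "I \<subseteq> {1..2 ^ h}" using p that by (auto simp: partition_on_def)
    then show "z l i = z' l i" using assms li by blast
  qed
  then show "exp ((\<Sum>I\<in>m. block_energy r z I / 3) - 4 * real (card m)) =
    exp ((\<Sum>I\<in>m. block_energy r z' I / 3) - 4 * real (card m))" by simp
qed

text \<open>\<open>X_mat\<close> is cut off outside its index range and \<open>noise\<close> is not,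
  but the excess reads only rows 1 to r and the columns reached by g.\<close>

lemma expectation_noise_excess_columns:
  assumes s: "s \<in> prob_mats r n" and g: "inj_on g {1..2 ^ h}" "g ` {1..2 ^ h} \<subseteq> {1..n}"
  shows "(\<integral>\<^sup>+ y. ennreal (noise_excess r h (\<lambda>l i. X_mat r n y l (g i) - s l (g i))) \<partial>measure_pmf (law n s)) \<le> 1"
proof -
  let ?P = "\<lambda>i. embed_pmf (\<lambda>l. s l i)"
  have "(\<integral>\<^sup>+ y. ennreal (noise_excess r h (\<lambda>l i. X_mat r n y l (g i) - s l (g i))) \<partial>measure_pmf (law n s))
      = (\<integral>\<^sup>+ y. ennreal (noise_excess r h (\<lambda>l i. noise ?P y l (g i))) \<partial>measure_pmf (law n s))"
  proof (intro nn_integral_cong arg_cong[where f = ennreal] noise_excess_cong)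
    fix y and l i :: nat assume "l \<in> {1..r}" "i \<in> {1..2 ^ h}"
    with g(2) have "l \<in> {1..r}" "g i \<in> {1..n}" by (blast, blast)
    then show "X_mat r n y l (g i) - s l (g i) = noise ?P y l (g i)"
      using pmf_column[OF s] by (simp add: X_mat_def noise_def)
  qed
  also have "\<dots> \<le> 1"
    unfolding law_def
    by (rule expectation_noise_excess_le[OF finite_atLeastAtMost _ g]) (rule set_pmf_column[OF s])
  finally show ?thesis .
qed

lemma mnorm_sq_even_odd:
  "(mnorm r (2 * q) t)\<^sup>2 = (mnorm r q (even_cols t))\<^sup>2 + (mnorm r q (odd_cols t))\<^sup>2"
proof -
  have "(\<Sum>i\<in>{1..2 * q}. f i) = (\<Sum>i\<in>{1..q}. f (2 * i)) + (\<Sum>i\<in>{1..q}. f (2 * i - 1))" for f :: "nat \<Rightarrow> real"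
    by (induction q) (simp_all add: add_ac)
  then show ?thesis
    unfolding mnorm_sq even_cols_def odd_cols_def by (simp add: sum.distrib)
qed

lemma mnorm_diff_sq_le:
  "(mnorm r q (a - b))\<^sup>2 \<le> 2 * (mnorm r q (c - a))\<^sup>2 + 2 * (mnorm r q (c - b))\<^sup>2"
  unfolding mnorm_sq sum_distrib_left sum.distrib[symmetric]
  by (intro sum_mono) (simp, rule square_diff_le)

lemma mnorm_diff_commute: "(mnorm r q (a - b))\<^sup>2 = (mnorm r q (b - a))\<^sup>2"
  unfolding mnorm_sq by (intro sum.cong refl) (simp add: power2_commute)

section \<open>Pathwise loss of the two selection stages\<close>

lemma built_on_refines:
  assumes m0: "partition_on A m0" and m: "partition_on A m" and u: "\<And>I. I \<in> m \<Longrightarrow> \<exists>J\<subseteq>m0. I = \<Union>J"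
    and J: "J \<in> m0"
  shows "\<exists>I\<in>m. J \<subseteq> I"
proof -
  obtain x where x: "x \<in> J" using m0 J by (auto simp: partition_on_def) (metis ex_in_conv)
  then have "x \<in> A" using m0 J by (auto simp: partition_on_def)
  then obtain I where I: "I \<in> m" "x \<in> I" using m by (auto simp: partition_on_def)
  then obtain JJ where JJ: "JJ \<subseteq> m0" "I = \<Union>JJ" using u by blast
  then obtain J' where J': "J' \<in> JJ" "x \<in> J'" using I(2) by blast
  then have "J' = J" using m0 J JJ(1) x by (auto simp: partition_on_def disjoint_def)
  then show ?thesis using I(1) JJ(2) J'(1) by blast
qed

lemma card_built_on_le:
  assumes m0: "partition_on A m0" "finite A" and m: "partition_on A m"
    and u: "\<And>I. I \<in> m \<Longrightarrow> \<exists>J\<subseteq>m0. I = \<Union>J"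
  shows "card m \<le> card m0"
proof -
  have "\<forall>J\<in>m0. \<exists>I. I \<in> m \<and> J \<subseteq> I" using built_on_refines[OF m0(1) m u] by blast
  then obtain f where f: "\<And>J. J \<in> m0 \<Longrightarrow> f J \<in> m \<and> J \<subseteq> f J" by metis
  have "m \<subseteq> f ` m0"
  proof
    fix I assume I: "I \<in> m"
    obtain x where x: "x \<in> I" using m I by (auto simp: partition_on_def) (metis ex_in_conv)
    then have "x \<in> A" using m I by (auto simp: partition_on_def)
    then obtain J where J: "J \<in> m0" "x \<in> J" using m0 by (auto simp: partition_on_def)
    then have "f J = I" using f[OF J(1)] m I x by (auto simp: partition_on_def disjoint_def)
    then show "I \<in> f ` m0" using J by auto
  qed
  then show ?thesis using finite_elements[OF m0(2,1)] by (meson card_image_le card_mono finite_imageI le_trans)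
qed

lemma pc_dim_partition:
  assumes "partition_on A m" "finite A"
  shows "pc_dim m = card m"
  using assms by (intro pc_dim_eq_card finite_elements[OF assms(2,1)]) (auto simp: partition_on_def)

lemma dyadic_partitionsD:
  assumes "m \<in> dyadic_partitions N"
  shows "partition_on {1..2 ^ (N - 1)} m" "m \<in> dyadic_block_partitions (N - 1) 0" "m \<subseteq> dyadic_blocks" "finite m"
  using assms dyadic_partitions_subset[of N] finite_elements[of "{1..2 ^ (N - 1)}" m]
  by (auto simp: dyadic_partitions_def dyadic_block_partitions_def)

text \<open>The threshold 49 is 4 times 12, plus 1. The noise on the common refinement costs 48
  pieces for each of m and m0; the penalty absorbs the share of m0 and leaves one
  \<open>card m0\<close> on the left, which is how the size of the selected partition gets
  controlled.\<close>

lemma stage_one_bound: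
  assumes m: "m \<in> dyadic_partitions N" and c0: "49 < c0"
    and sel: "is_arg_min (\<lambda>m. (mnorm r q (x - lse r q m x))\<^sup>2 + c0 * real (pc_dim m))
             (\<lambda>m. m \<in> dyadic_partitions N) m0" and q: "q = 2 ^ (N - 1)"
  shows "(mnorm r q (s - lse r q m0 x))\<^sup>2 / 2 + real (card m0) \<le>
    3 / 2 * (mnorm r q (s - block_mean r m s))\<^sup>2 + (c0 + 48) * real (card m) + 24 * noise_excess r (N - 1) (x - s)"
proof -
  have m0: "m0 \<in> dyadic_partitions N" using sel by (simp add: is_arg_min_linorder)
  note M = dyadic_partitionsD[OF m, folded q] and M0 = dyadic_partitionsD[OF m0, folded q]
  let ?t = "lse r q m0 x" and ?u = "block_mean r m s" and ?j = "common_refinement m m0"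
  have dims: "pc_dim m = card m" "pc_dim m0 = card m0"
    using pc_dim_partition[OF M(1)] pc_dim_partition[OF M0(1)] by simp_all
  have "(mnorm r q (x - ?t))\<^sup>2 + c0 * real (card m0) \<le> (mnorm r q (x - lse r q m x))\<^sup>2 + c0 * real (card m)"
    using sel m unfolding is_arg_min_linorder dims[symmetric] by blast
  also have "\<dots> \<le> (mnorm r q (x - ?u))\<^sup>2 + c0 * real (card m)"
    using lse_le[OF M(1) block_mean_pc_mats[OF M(1)]] by simp
  finally have "(mnorm r q (s - ?t))\<^sup>2 / 2 + c0 * real (card m0)
    \<le> 3 / 2 * (mnorm r q (s - ?u))\<^sup>2 + c0 * real (card m) + 4 * (\<Sum>I\<in>?j. block_energy r (x - s) I)"
  proof (rule selection_inequality[OF partition_on_common_refinement[OF M(1) M0(1)], rotated])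
    fix l K i i' assume l: "l \<in> {1..r}" and K: "K \<in> ?j" "i \<in> K" "i' \<in> K"
    then obtain I I' where I: "I \<in> m" "I' \<in> m0" "K = I \<inter> I'" by (auto simp: common_refinement_def)
    have "?t l i = ?t l i'" by (rule pc_mats_const_on[OF M0(1) lse_pc_mats[OF M0(1)] l I(2)]) (use I K in auto)
    moreover have "?u l i = ?u l i'"
      by (rule pc_mats_const_on[OF M(1) block_mean_pc_mats[OF M(1)] l I(1)]) (use I K in auto)
    ultimately show "?t l i - ?u l i = ?t l i' - ?u l i'" by simp
  qed
  moreover have "(\<Sum>I\<in>?j. block_energy r (x - s) I)
      \<le> (\<Sum>I\<in>m. block_energy r (x - s) I) + (\<Sum>I\<in>m0. block_energy r (x - s) I)"
    by (rule sum_common_refinement_le[OF M(3) M0(3) M(4) M0(4) block_energy_nonneg])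
  moreover note energy_le_noise_excess[OF M(2), of r "x - s"] energy_le_noise_excess[OF M0(2), of r "x - s"]
  moreover have "49 * real (card m0) \<le> c0 * real (card m0)" using c0 by (intro mult_right_mono) auto
  ultimately show ?thesis by (simp add: algebra_simps)
qed

text \<open>The partition m0 is itself a candidate. Every candidate is coarser than m0, so the
  difference between the estimate and u is constant on the pieces of m0, and only the noise energy
  of m0 appears, never that of the selected m.\<close>

lemma stage_two_bound:
  assumes m0: "m0 \<in> dyadic_partitions N" and q: "q = 2 ^ (N - 1)" and c: "0 < c1" "0 < c2"
    and sel: "is_arg_min (\<lambda>m. (mnorm r q (x - lse r q m x))\<^sup>2 + hybrid_pen c1 c2 m0 m)
             (\<lambda>m. m \<in> built_on q m0) m"
    and u: "u \<in> pc_mats r q m0"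
  shows "(mnorm r q (s - lse r q m x))\<^sup>2 / 2 \<le>
    3 / 2 * (mnorm r q (s - u))\<^sup>2 + (c1 + 48) * real (card m0) + 12 * noise_excess r (N - 1) (x - s)"
proof -
  note M0 = dyadic_partitionsD[OF m0, folded q]
  have mb: "m \<in> built_on q m0" using sel by (simp add: is_arg_min_linorder)
  have m: "partition_on {1..q} m" and mu: "\<And>I. I \<in> m \<Longrightarrow> \<exists>J\<subseteq>m0. I = \<Union>J"
    using mb by (auto simp: built_on_def interval_partitions_def)
  have m0b: "m0 \<in> built_on q m0"
  proof -
    have "\<exists>a b. I = {a..b}" if "I \<in> m0" for I
      using m0 that by (auto simp: dyadic_partitions_def dyadic_intervals_def)
    moreover have "\<exists>J\<subseteq>m0. I = \<Union>J" if "I \<in> m0" for I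
      using that by (intro exI[of _ "{I}"]) auto
    ultimately show ?thesis using M0(1) by (simp add: built_on_def interval_partitions_def)
  qed
  have dims: "pc_dim m = card m" "pc_dim m0 = card m0"
    using pc_dim_partition[OF m] pc_dim_partition[OF M0(1)] by simp_all
  have "{1..q} \<noteq> {}" using q by simp
  then have "m \<noteq> {}" "m0 \<noteq> {}" using m M0(1) by (auto simp: partition_on_def)
  then have pos: "0 < card m" "0 < card m0" using finite_elements[OF _ m] M0(4) by (auto simp: card_gt_0_iff)
  have "card m \<le> card m0" by (rule card_built_on_le[OF M0(1) _ m mu]) auto
  \<comment> \<open>A candidate has no more pieces than m0, so the penalty is nonnegative; at m0 the
    logarithm vanishes.\<close>
  then have "0 \<le> ln (real (card m0) / real (card m))" using pos by (intro ln_ge_zero) (simp add: field_simps)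
  then have pen: "0 \<le> hybrid_pen c1 c2 m0 m" unfolding hybrid_pen_def dims using c by simp
  have pen0: "hybrid_pen c1 c2 m0 m0 = c1 * real (card m0)" unfolding hybrid_pen_def dims using pos by simp
  let ?t = "lse r q m x"
  have "(mnorm r q (x - ?t))\<^sup>2 + 0 \<le> (mnorm r q (x - ?t))\<^sup>2 + hybrid_pen c1 c2 m0 m" using pen by simp
  also have "\<dots> \<le> (mnorm r q (x - lse r q m0 x))\<^sup>2 + hybrid_pen c1 c2 m0 m0"
    using sel m0b unfolding is_arg_min_linorder by blast
  also have "\<dots> \<le> (mnorm r q (x - u))\<^sup>2 + c1 * real (card m0)"
    unfolding pen0 using lse_le[OF M0(1) u] by simp
  finally have "(mnorm r q (s - ?t))\<^sup>2 / 2 + 0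
    \<le> 3 / 2 * (mnorm r q (s - u))\<^sup>2 + c1 * real (card m0) + 4 * (\<Sum>I\<in>m0. block_energy r (x - s) I)"
  proof (rule selection_inequality[OF M0(1), rotated])
    fix l K i i' assume l: "l \<in> {1..r}" and K: "K \<in> m0" "i \<in> K" "i' \<in> K"
    obtain I where I: "I \<in> m" "K \<subseteq> I" using built_on_refines[OF M0(1) m mu K(1)] by blast
    have "?t l i = ?t l i'" by (rule pc_mats_const_on[OF m lse_pc_mats[OF m] l I(1)]) (use I K in auto)
    moreover have "u l i = u l i'" by (rule pc_mats_const_on[OF M0(1) u l K])
    ultimately show "?t l i - u l i = ?t l i' - u l i'" by simp
  qed
  then show ?thesis using energy_le_noise_excess[OF M0(2), of r "x - s"] by (simp add: algebra_simps)
qed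

text \<open>The first-stage estimate, computed from the even columns, serves as the point u for the
  odd ones. The discrepancy between the halves is paid twice: when that estimate is transferred to
  the odd columns, and when the final one is transferred back.\<close>

lemma hybrid_loss_bound:
  assumes hyb: "is_hybrid c0 c1 c2 r N e" and N: "1 \<le> N" and y: "y \<in> observations r (2 ^ N)"
    and m: "m \<in> dyadic_partitions N" and c: "49 < c0" "0 < c1" "0 < c2"
  defines "q \<equiv> 2 ^ (N - 1)" and "x \<equiv> X_mat r (2 ^ N) y"
  shows "(mnorm r (2 ^ N) (s - e y))\<^sup>2 \<le> 20 * (mnorm r q (even_cols s - odd_cols s))\<^sup>2
    + (324 + 6 * c1) * (3 / 2 * (mnorm r q (even_cols s - block_mean r m (even_cols s)))\<^sup>2
        + (c0 + 48) * real (card m) + 24 * noise_excess r (N - 1) (even_cols x - even_cols s))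
    + 72 * noise_excess r (N - 1) (odd_cols x - odd_cols s)"
proof -
  obtain m0 m1 where h:
    "is_arg_min (\<lambda>m. (mnorm r q (even_cols x - lse r q m (even_cols x)))\<^sup>2 + c0 * real (pc_dim m))
       (\<lambda>m. m \<in> dyadic_partitions N) m0"
    "is_arg_min (\<lambda>m. (mnorm r q (odd_cols x - lse r q m (odd_cols x)))\<^sup>2 + hybrid_pen c1 c2 m0 m)
       (\<lambda>m. m \<in> built_on q m0) m1"
    "even_cols (e y) = lse r q m1 (odd_cols x)" "odd_cols (e y) = lse r q m1 (odd_cols x)"
    using hyb[unfolded is_hybrid_def Let_def]
    by (elim exE) (drule bspec[OF _ y], elim conjE, rule that[unfolded q_def x_def], assumption+)
  define t where "t = lse r q m0 (even_cols x)"
  define t' where "t' = lse r q m1 (odd_cols x)"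
  define G where "G = 3 / 2 * (mnorm r q (even_cols s - block_mean r m (even_cols s)))\<^sup>2
        + (c0 + 48) * real (card m) + 24 * noise_excess r (N - 1) (even_cols x - even_cols s)"
  have m0: "m0 \<in> dyadic_partitions N" using h(1) by (simp add: is_arg_min_linorder)
  have t: "t \<in> pc_mats r q m0"
    unfolding t_def using lse_pc_mats[OF dyadic_partitionsD(1)[OF m0]] by (simp add: q_def)
  have 1: "(mnorm r q (even_cols s - t))\<^sup>2 / 2 + real (card m0) \<le> G"
    unfolding G_def t_def by (rule stage_one_bound[OF m c(1) h(1) meta_eq_to_obj_eq[OF q_def]])
  have 2: "(mnorm r q (odd_cols s - t'))\<^sup>2 / 2 \<le> 3 / 2 * (mnorm r q (odd_cols s - t))\<^sup>2
      + (c1 + 48) * real (card m0) + 12 * noise_excess r (N - 1) (odd_cols x - odd_cols s)"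
    unfolding t'_def by (rule stage_two_bound[OF m0 meta_eq_to_obj_eq[OF q_def] c(2,3) h(2) t])
  have "0 \<le> (mnorm r q (even_cols s - t))\<^sup>2" by simp
  then have "real (card m0) \<le> G" using 1 by linarith
  then have 3: "(c1 + 48) * real (card m0) \<le> (c1 + 48) * G" using c by (intro mult_left_mono) auto
  have 4: "(mnorm r q (even_cols s - t))\<^sup>2 \<le> 2 * G" using 1 of_nat_0_le_iff[of "card m0", where 'a = real] by linarith
  have 5: "(mnorm r q (odd_cols s - t))\<^sup>2 \<le> 2 * (mnorm r q (even_cols s - odd_cols s))\<^sup>2 + 2 * (mnorm r q (even_cols s - t))\<^sup>2"
    by (rule mnorm_diff_sq_le)
  have 6: "(mnorm r q (even_cols s - t'))\<^sup>2 \<le> 2 * (mnorm r q (even_cols s - odd_cols s))\<^sup>2 + 2 * (mnorm r q (odd_cols s - t'))\<^sup>2"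
    using mnorm_diff_sq_le[of r q "even_cols s" t' "odd_cols s"]
    by (simp add: mnorm_diff_commute[of r q "odd_cols s" "even_cols s"])
  have "2 ^ N = 2 * q" using N by (simp add: q_def flip: power_Suc)
  moreover have "even_cols (s - e y) = even_cols s - t'" "odd_cols (s - e y) = odd_cols s - t'"
    unfolding t'_def h(3)[symmetric] using h(4)[folded h(3)] h(4)
    by (simp_all add: fun_eq_iff even_cols_def odd_cols_def)
  ultimately have 7: "(mnorm r (2 ^ N) (s - e y))\<^sup>2 = (mnorm r q (even_cols s - t'))\<^sup>2 + (mnorm r q (odd_cols s - t'))\<^sup>2"
    by (simp add: mnorm_sq_even_odd)
  \<comment> \<open>In the inequality that follows, A + B \<le> 2D + 3B and B \<le> 6D + 12G + 2H +
    24Z. With H = (c1 + 48) G the coefficient of G is 36 + 6 (c1 + 48), and 324 = 36 + 288.\<close>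
  have "(324 + 6 * c1) * G = 36 * G + 6 * ((c1 + 48) * G)" by (simp add: algebra_simps)
  moreover have "A + B \<le> 20 * D + (36 * G + 6 * H) + 72 * Z"
    if "B / 2 \<le> 3 / 2 * E + h + 12 * Z" "h \<le> H" "F \<le> 2 * G" "E \<le> 2 * D + 2 * F" "A \<le> 2 * D + 2 * B"
    for A B D E F H Z h :: real
    using that by argo
  ultimately show ?thesis unfolding G_def[symmetric] 7 using 2 3 4 5 6 by metis
qed

section \<open>Expected loss against the minimax risk\<close>

lemma nn_integral_affine_le:
  fixes f g :: "'a \<Rightarrow> real"
  assumes "(\<integral>\<^sup>+ y. ennreal (f y) \<partial>measure_pmf P) \<le> 1" "(\<integral>\<^sup>+ y. ennreal (g y) \<partial>measure_pmf P) \<le> 1"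
    and "\<And>y. 0 \<le> f y" "\<And>y. 0 \<le> g y" "0 \<le> a" "0 \<le> b" "0 \<le> c"
  shows "(\<integral>\<^sup>+ y. ennreal (a + b * f y + c * g y) \<partial>measure_pmf P) \<le> ennreal (a + b + c)"
proof -
  have "(\<integral>\<^sup>+ y. ennreal (a + b * f y + c * g y) \<partial>measure_pmf P)
      = (\<integral>\<^sup>+ y. ennreal a + ennreal b * ennreal (f y) + ennreal c * ennreal (g y) \<partial>measure_pmf P)"
    using assms by (intro nn_integral_cong) (simp add: ennreal_mult)
  also have "\<dots> = ennreal a + ennreal b * (\<integral>\<^sup>+ y. ennreal (f y) \<partial>measure_pmf P)
      + ennreal c * (\<integral>\<^sup>+ y. ennreal (g y) \<partial>measure_pmf P)"
    by (simp add: nn_integral_add nn_integral_cmult)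
  also have "\<dots> \<le> ennreal a + ennreal b * 1 + ennreal c * 1"
    using assms by (intro add_mono mult_left_mono) auto
  finally show ?thesis using assms by simp
qed

lemma hybrid_risk_bound:
  assumes hyb: "is_hybrid c0 c1 c2 r N e" and N: "1 \<le> N" and s: "s \<in> prob_mats r (2 ^ N)"
    and m: "m \<in> dyadic_partitions N" and c: "49 < c0" "0 < c1" "0 < c2"
  defines "q \<equiv> 2 ^ (N - 1)"
  shows "risk r (2 ^ N) s e \<le> ennreal (20 * (mnorm r q (even_cols s - odd_cols s))\<^sup>2
    + (324 + 6 * c1) * (3 / 2 * (mnorm r q (even_cols s - block_mean r m (even_cols s)))\<^sup>2
        + (c0 + 48) * real (card m) + 24) + 72)"
proof -
  have n: "2 ^ N = 2 * q" using N by (simp add: q_def flip: power_Suc)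
  let ?x = "X_mat r (2 ^ N)"
  define a where "a = 20 * (mnorm r q (even_cols s - odd_cols s))\<^sup>2
    + (324 + 6 * c1) * (3 / 2 * (mnorm r q (even_cols s - block_mean r m (even_cols s)))\<^sup>2 + (c0 + 48) * real (card m))"
  define b where "b = (324 + 6 * c1) * 24"
  have "risk r (2 ^ N) s e \<le> (\<integral>\<^sup>+ y. ennreal (a + b * noise_excess r (N - 1) (even_cols (?x y) - even_cols s)
      + 72 * noise_excess r (N - 1) (odd_cols (?x y) - odd_cols s)) \<partial>measure_pmf (law (2 ^ N) s))"
    unfolding risk_def
  proof (intro nn_integral_mono_AE, subst AE_measure_pmf_iff, intro ballI ennreal_leI)
    fix y assume "y \<in> set_pmf (law (2 ^ N) s)"
    then have y: "y \<in> observations r (2 ^ N)" using set_pmf_law[OF s] by auto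
    show "(mnorm r (2 ^ N) (s - e y))\<^sup>2 \<le> a + b * noise_excess r (N - 1) (even_cols (?x y) - even_cols s)
      + 72 * noise_excess r (N - 1) (odd_cols (?x y) - odd_cols s)"
      using hybrid_loss_bound[OF hyb N y m c, of s] unfolding a_def b_def q_def by argo
  qed
  also have "\<dots> \<le> ennreal (a + b + 72)"
  proof (rule nn_integral_affine_le)
    have "(\<integral>\<^sup>+ y. ennreal (noise_excess r (N - 1) (\<lambda>l i. ?x y l (2 * i) - s l (2 * i))) \<partial>measure_pmf (law (2 ^ N) s)) \<le> 1"
      by (rule expectation_noise_excess_columns[OF s]) (auto simp: inj_on_def n q_def)
    then show "(\<integral>\<^sup>+ y. ennreal (noise_excess r (N - 1) (even_cols (?x y) - even_cols s)) \<partial>measure_pmf (law (2 ^ N) s)) \<le> 1"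
      by (simp add: even_cols_def fun_diff_def)
    have "(\<integral>\<^sup>+ y. ennreal (noise_excess r (N - 1) (\<lambda>l i. ?x y l (2 * i - 1) - s l (2 * i - 1))) \<partial>measure_pmf (law (2 ^ N) s)) \<le> 1"
      by (rule expectation_noise_excess_columns[OF s]) (auto simp: inj_on_def n q_def)
    then show "(\<integral>\<^sup>+ y. ennreal (noise_excess r (N - 1) (odd_cols (?x y) - odd_cols s)) \<partial>measure_pmf (law (2 ^ N) s)) \<le> 1"
      by (simp add: odd_cols_def fun_diff_def)
  qed (use c in \<open>auto simp: a_def b_def noise_excess_nonneg\<close>)
  finally show ?thesis unfolding a_def b_def by (simp add: distrib_left add_ac)
qed

lemma hybrid_minimax:
  fixes \<alpha> p R K c0 c1 c2 :: real and r N :: nat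
  assumes c: "49 < c0" "0 < c1" "0 < c2" and K: "0 < K" and p: "0 < p" "p \<le> 2" and \<alpha>: "1 / p - 1 / 2 < \<alpha>"
    and r: "2 \<le> r" and N: "1 \<le> N" and R: "1 \<le> sqrt (2 ^ N) * R" "R < (2 ^ N) powr \<alpha>"
    and hyb: "is_hybrid c0 c1 c2 r N e" and s: "s \<in> prob_besov r N \<alpha> p R"
    and \<Delta>: "(mnorm r (2 ^ (N - 1)) (even_cols s - odd_cols s))\<^sup>2 \<le> K * ln (2 ^ N)"
  shows "risk r (2 ^ N) s e \<le>
    ennreal (32 * (20 * K + (324 + 6 * c1) * (26 + 4 * (c0 + 48)) + 72) * ln (2 ^ N)) * minimax_risk r N \<alpha> p R"
proof -
  define \<rho> where "\<rho> = (sqrt (2 ^ N) * R) powr (2 / (2 * \<alpha> + 1))"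
  define C where "C = 20 * K + (324 + 6 * c1) * (26 + 4 * (c0 + 48)) + 72"
  have \<alpha>0: "0 < \<alpha>"
  proof -
    have "1 / 2 \<le> 1 / p" using p by (simp add: field_simps)
    then show ?thesis using \<alpha> by linarith
  qed
  have \<rho>1: "1 \<le> \<rho>" unfolding \<rho>_def using R \<alpha>0 by (intro ge_one_powr_ge_zero) auto
  have sP: "s \<in> prob_mats r (2 ^ N)" and sB: "s \<in> besov_body r N \<alpha> p R"
    using s by (auto simp: prob_besov_def)
  obtain m where m: "m \<in> dyadic_partitions N"
    "(mnorm r (2 ^ (N - 1)) (even_cols s - block_mean r m (even_cols s)))\<^sup>2 \<le> \<rho>" "real (card m) \<le> 1 + 3 * real N * \<rho>"
    using besov_approximation[OF sB p \<alpha> N R(1)] unfolding \<rho>_def by blast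
  \<comment> \<open>With \<rho> \<ge> 1 and N \<ge> 1 the product dominates 1, \<rho> and N, so
    every term of the risk bound becomes a multiple of T.\<close>
  define T where "T = real N * \<rho>"
  have T: "1 \<le> T" "\<rho> \<le> T" "real N \<le> T"
    unfolding T_def using \<rho>1 N by (auto intro: mult_ge1_I simp: mult_le_cancel_left1 mult_le_cancel_right1)
  have ln2: "1 / 2 \<le> ln (2 :: real)" using ln2_ge_two_thirds by linarith
  have lnN: "ln (2 ^ N) = real N * ln (2 :: real)" by (simp add: ln_realpow)
  have "ln (2 :: real) \<le> 1" using ln_le_minus_one[of 2] by simp
  then have "K * (real N * ln 2) \<le> K * (T * 1)" using K T by (intro mult_left_mono mult_mono) auto
  then have 1: "20 * (mnorm r (2 ^ (N - 1)) (even_cols s - odd_cols s))\<^sup>2 \<le> 20 * K * T"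
    using \<Delta> unfolding lnN by simp
  have "real (card m) \<le> 4 * T" using m(3) T unfolding T_def by linarith
  then have "(c0 + 48) * real (card m) \<le> (c0 + 48) * (4 * T)" using c by (intro mult_left_mono) auto
  then have "3 / 2 * (mnorm r (2 ^ (N - 1)) (even_cols s - block_mean r m (even_cols s)))\<^sup>2
      + (c0 + 48) * real (card m) + 24 \<le> (26 + 4 * (c0 + 48)) * T"
    using m(2) T by (simp add: distrib_right)
  then have 2: "(324 + 6 * c1) * (3 / 2 * (mnorm r (2 ^ (N - 1)) (even_cols s - block_mean r m (even_cols s)))\<^sup>2
      + (c0 + 48) * real (card m) + 24) \<le> (324 + 6 * c1) * ((26 + 4 * (c0 + 48)) * T)"
    using c by (intro mult_left_mono) auto
  have C0: "0 \<le> C" using K c by (auto simp: C_def)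
  have "risk r (2 ^ N) s e \<le> ennreal (20 * (mnorm r (2 ^ (N - 1)) (even_cols s - odd_cols s))\<^sup>2
    + (324 + 6 * c1) * (3 / 2 * (mnorm r (2 ^ (N - 1)) (even_cols s - block_mean r m (even_cols s)))\<^sup>2
        + (c0 + 48) * real (card m) + 24) + 72)"
    by (rule hybrid_risk_bound[OF hyb N sP m(1) c])
  also have "\<dots> \<le> ennreal (C * T)"
    using 1 2 T by (intro ennreal_leI) (simp add: C_def distrib_right mult.assoc)
  also have "\<dots> \<le> ennreal (32 * C * ln (2 ^ N) * (\<rho> / 16))"
  proof (rule ennreal_leI)
    \<comment> \<open>The factor 32 is 16 from the lower bound times 2 from 1 \<le> 2 ln 2, which
      trades N for ln n.\<close>
    have "C * \<rho> * real N * 1 \<le> C * \<rho> * real N * (2 * ln 2)"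
      using C0 \<rho>1 ln2 by (intro mult_left_mono) auto
    then show "C * T \<le> 32 * C * ln (2 ^ N) * (\<rho> / 16)" unfolding T_def lnN by (simp add: algebra_simps)
  qed
  also have "\<dots> = ennreal (32 * C * ln (2 ^ N)) * ennreal (\<rho> / 16)"
    using C0 \<rho>1 by (intro ennreal_mult) (auto simp: lnN)
  also have "\<dots> \<le> ennreal (32 * C * ln (2 ^ N)) * minimax_risk r N \<alpha> p R"
    using minimax_risk_lower_bound[OF r p(1) \<alpha>0 R] unfolding \<rho>_def by (intro mult_left_mono) auto
  finally show ?thesis unfolding C_def .
qed

theorem theorem3:
  shows "\<exists>c0_min c1_min c2_min :: real. 0 < c0_min \<and> 0 < c1_min \<and> 0 < c2_min \<and>
    (\<forall>(K :: real) (c0 :: real) (c1 :: real) (c2 :: real) (\<alpha> :: real) (p :: real).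
       0 < K \<and> c0_min < c0 \<and> c1_min < c1 \<and> c2_min < c2 \<and> 0 < p \<and> p \<le> 2 \<and> 1 / p - 1 / 2 < \<alpha> \<longrightarrow>
       (\<exists>C :: real. 0 < C \<and>
          (\<forall>(r :: nat) (N :: nat) (n :: nat) (R :: real) (s_hyb :: (nat \<Rightarrow> nat) \<Rightarrow> rmat).
             2 \<le> r \<and> n = 2 ^ N \<and> 2 \<le> n \<and> real n powr (- 1 / 2) \<le> R \<and> R < real n powr \<alpha> \<and>
             is_hybrid c0 c1 c2 r N s_hyb \<longrightarrow>
             (SUP s \<in> {s \<in> prob_besov r N \<alpha> p R.
                         (mnorm r (n div 2) (even_cols s - odd_cols s))\<^sup>2 \<le> K * ln (real n)}.
                risk r n s s_hyb)
             \<le> ennreal (C * ln (real n)) * minimax_risk r N \<alpha> p R)))"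
\<comment> \<open>The first stage requires 49; for c1 and c2 the second stage asks for positivity,
  which the threshold 1 ensures.\<close>
proof (rule exI[of _ 49], rule exI[of _ 1], rule exI[of _ 1], intro conjI allI impI, goal_cases)
  case (4 K c0 c1 c2 \<alpha> p)
  then have c: "49 < c0" "0 < c1" "0 < c2" and K: "0 < K" and p: "0 < p" "p \<le> 2" and \<alpha>: "1 / p - 1 / 2 < \<alpha>"
    by auto
  define C where "C = 32 * (20 * K + (324 + 6 * c1) * (26 + 4 * (c0 + 48)) + 72)"
  have "0 < C" unfolding C_def using K c by (intro mult_pos_pos add_pos_pos) auto
  moreover have "(SUP s \<in> {s \<in> prob_besov r N \<alpha> p R.
                         (mnorm r (n div 2) (even_cols s - odd_cols s))\<^sup>2 \<le> K * ln (real n)}.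
                risk r n s s_hyb) \<le> ennreal (C * ln (real n)) * minimax_risk r N \<alpha> p R"
    if H: "2 \<le> r \<and> n = 2 ^ N \<and> 2 \<le> n \<and> real n powr (- 1 / 2) \<le> R \<and> R < real n powr \<alpha> \<and>
             is_hybrid c0 c1 c2 r N s_hyb" for r N n :: nat and R :: real and s_hyb
  proof (rule SUP_least)
    fix s assume s: "s \<in> {s \<in> prob_besov r N \<alpha> p R.
                         (mnorm r (n div 2) (even_cols s - odd_cols s))\<^sup>2 \<le> K * ln (real n)}"
    have n: "n = 2 ^ N" and r: "2 \<le> r" and hyb: "is_hybrid c0 c1 c2 r N s_hyb" using H by auto
    have N: "1 \<le> N" using H by (cases N) auto
    have q: "n div 2 = 2 ^ (N - 1)" unfolding n using N by (cases N) auto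
    \<comment> \<open>The lower bound on R becomes sqrt n R \<ge> 1, that is, \<rho> \<ge>
      1.\<close>
    have "1 = sqrt (2 ^ N) * (2 ^ N) powr (- 1 / 2)"
      by (simp add: powr_half_sqrt[symmetric] powr_add[symmetric])
    also have "\<dots> \<le> sqrt (2 ^ N) * R" using H unfolding n by (intro mult_left_mono) auto
    finally have R: "1 \<le> sqrt (2 ^ N) * R" .
    have R': "R < (2 ^ N) powr \<alpha>" using H unfolding n by simp
    show "risk r n s s_hyb \<le> ennreal (C * ln (real n)) * minimax_risk r N \<alpha> p R"
      using hybrid_minimax[OF c K p \<alpha> r N R R' hyb, of s] s unfolding C_def q unfolding n by simp
  qed
  ultimately show ?case by blast
qed simp_all

end
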